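(* Let $\Pi$ be an $\mathsf{LCL}$ problem for which no certificate for $O(1)$ solvability exists. Then the randomized and the deterministic complexity of $\Pi$ in the $\mathsf{LOCAL}$ model (on $n$-node full $\delta$-ary rooted trees) is $\Omega(\log^* n)$.
   Context: An $\mathsf{LCL}$ problem is a triple $\Pi=(\delta,\Sigma(\Pi),\mathcal C(\Pi))$ where $\delta\ge 1$ is an integer, $\Sigma(\Pi)$ is a finite set of labels, and $\mathcal C(\Pi)\subseteq\Sigma(\Pi)^{\delta+1}$ is a set of allowed configurations, written $(a:b_1,\dots,b_\delta)$; the order of $b_1,\dots,b_\delta$ is irrelevant. Inputs are unlabeled full $\delta$-ary rooted trees (every node has exactly $\delta$ or $0$ children). A labeling $\lambda$ of the nodes of a tree by $\Sigma(\Pi)$ is correct (a solution) if for every node $v$ with $\delta$ children $v_1,\dots,v_\delta$ there is a permutation $\rho$ of $\{1,\dots,\delta\}$ with $(\lambda(v):\lambda(v_{\rho(1)}),\dots,\lambda(v_{\rho(\delta)}))\in\mathcal C(\Pi)$; nodes whose number of children is not $\delta$ are unconstrained. Certificate for $O(\log^* n)$ solvability: a nonempty label set $\Sigma_{\mathcal T}=\{\sigma_1,\dots,\sigma_t\}\subseteq\Sigma(\Pi)$, a depth $d\ge 1$, and labeled trees $\mathcal T=(\mathcal T_1,\dots,\mathcal T_t)$ such that (1) each $\mathcal T_i$ is a complete $\delta$-ary tree of depth $d$ (every non-leaf has $\delta$ children, all leaves at distance $d$ from the root); (2) each $\mathcal T_i$ is labeled with labels from $\Sigma_{\mathcal T}$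 and is correct with respect to $\mathcal C(\Pi)$; (3) the trees obtained from the $\mathcal T_i$ by erasing the labels of all non-leaf nodes are all isomorphic as rooted trees with labeled leaves; (4) the root of $\mathcal T_i$ is labeled $\sigma_i$. Certificate for $O(1)$ solvability: a pair consisting of a certificate $\mathcal T$ for $O(\log^* n)$ solvability and a configuration $(a:b_1,\dots,a,\dots,b_\delta)\in\mathcal C(\Pi)$ (i.e. the parent label $a$ also occurs among the child labels) such that all labels of the configuration lie in $\Sigma_{\mathcal T}$ and at least one leaf of the trees in $\mathcal T$ is labeled $a$. Model. In $\mathsf{LOCAL}$ on an $n$-node graph each node has a unique identifier from $\{1,\dots,\mathrm{poly}(n)\}$ and initially knows its identifier, its degree, $n$, the maximum degree, and which incident edge leads to its parent. In synchronous rounds nodes exchange unbounded messages with neighbors and do unbounded local computation; each node eventually outputs its label. The running time is the number of rounds until all nodes have output. In the randomized version each node has its own stream of random bits and the global output must be correct with probability at least $1-1/n$. The complexity of $\Pi$ is the best worst-case running time, as a function of $n$, of an algorithm solving $\Pi$. *)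

theory Defs
  imports "HOL-Probability.Probability" "HOL-Combinatorics.Permutations"
    "HOL-Library.Landau_Symbols"
begin

section \<open>Rooted trees\<close>

text \<open>A node is addressed by the list of child indices on the path from the root, so the root
  is \<open>[]\<close> and the children of \<open>v\<close> are \<open>v @ [0]\<close>, \<open>v @ [1]\<close>, \dots. The order
  of the children only serves to name the incident edges of a node; no notion about labelings
  below depends on it.\<close>

datatype rtree = Node (subtrees: "rtree list")

primrec is_node :: "rtree \<Rightarrow> nat list \<Rightarrow> bool" where
  "is_node t [] \<longleftrightarrow> True"
| "is_node t (i # v) \<longleftrightarrow> i < length (subtrees t) \<and> is_node (subtrees t ! i) v"

primrec subtree_at :: "rtree \<Rightarrow> nat list \<Rightarrow> rtree" where
  "subtree_at t [] = t"
| "subtree_at t (i # v) = subtree_at (subtrees t ! i) v"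

definition nodes :: "rtree \<Rightarrow> nat list set" where
  "nodes t = {v. is_node t v}"

definition arity :: "rtree \<Rightarrow> nat list \<Rightarrow> nat" where
  "arity t v = length (subtrees (subtree_at t v))"

definition leaves :: "rtree \<Rightarrow> nat list set" where
  "leaves t = {v \<in> nodes t. arity t v = 0}"

definition is_child :: "nat list \<Rightarrow> nat list \<Rightarrow> bool" where
  "is_child u v \<longleftrightarrow> (\<exists>i. v = u @ [i])"

definition degree :: "rtree \<Rightarrow> nat list \<Rightarrow> nat" where
  "degree t v = arity t v + (if v = [] then 0 else 1)"

definition max_degree :: "rtree \<Rightarrow> nat" where
  "max_degree t = Max (degree t ` nodes t)"

definition full_tree :: "nat \<Rightarrow> rtree \<Rightarrow> bool" where
  "full_tree \<delta> t \<longleftrightarrow> (\<forall>v \<in> nodes t. arity t v = \<delta> \<or> arity t v = 0)"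

definition complete_tree :: "nat \<Rightarrow> nat \<Rightarrow> rtree \<Rightarrow> bool" where
  "complete_tree \<delta> d t \<longleftrightarrow>
     (\<forall>v \<in> nodes t - leaves t. arity t v = \<delta>) \<and> (\<forall>v \<in> leaves t. length v = d)"

text \<open>Isomorphism of the rooted trees obtained by erasing the labels of all non-leaf nodes.\<close>

definition leaf_labeled_iso ::
    "rtree \<Rightarrow> (nat list \<Rightarrow> 'l) \<Rightarrow> rtree \<Rightarrow> (nat list \<Rightarrow> 'l) \<Rightarrow> bool" where
  "leaf_labeled_iso t lab t' lab' \<longleftrightarrow>
     (\<exists>f. bij_betw f (nodes t) (nodes t') \<and> f [] = [] \<and>
        (\<forall>u \<in> nodes t. \<forall>v \<in> nodes t. is_child u v \<longleftrightarrow> is_child (f u) (f v)) \<and>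
        (\<forall>v \<in> leaves t. lab v = lab' (f v)))"


section \<open>LCL problems and certificates\<close>

record 'l lcl =
  delta :: nat
  labels :: "'l set"
  configs :: "('l \<times> 'l list) set"

definition lcl_problem :: "'l lcl \<Rightarrow> bool" where
  "lcl_problem P \<longleftrightarrow> delta P \<ge> 1 \<and> finite (labels P) \<and>
     configs P \<subseteq> {(a, bs). a \<in> labels P \<and> set bs \<subseteq> labels P \<and> length bs = delta P}"

text \<open>The set of configurations need not be closed under reordering the child labels;
  the permutation in the definition of a solution makes their order irrelevant.\<close>

definition solution :: "'l lcl \<Rightarrow> rtree \<Rightarrow> (nat list \<Rightarrow> 'l) \<Rightarrow> bool" where
  "solution P t lab \<longleftrightarrow> (\<forall>v \<in> nodes t. lab v \<in> labels P) \<and>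
     (\<forall>v \<in> nodes t. arity t v = delta P \<longrightarrow>
        (\<exists>\<rho>. \<rho> permutes {..<delta P} \<and>
           (lab v, map (\<lambda>i. lab (v @ [\<rho> i])) [0..<delta P]) \<in> configs P))"

text \<open>The trees of a certificate are indexed by their root labels: for \<open>\<sigma> \<in> S\<close> the tree
  \<open>tr \<sigma>\<close> with the labeling \<open>lab \<sigma>\<close> is the one whose root is labeled \<open>\<sigma>\<close>.\<close>

definition log_star_certificate ::
    "'l lcl \<Rightarrow> 'l set \<Rightarrow> nat \<Rightarrow> ('l \<Rightarrow> rtree) \<Rightarrow> ('l \<Rightarrow> nat list \<Rightarrow> 'l) \<Rightarrow> bool" where
  "log_star_certificate P S d tr lab \<longleftrightarrow>
     S \<noteq> {} \<and> S \<subseteq> labels P \<and> d \<ge> 1 \<and>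
     (\<forall>\<sigma> \<in> S. complete_tree (delta P) d (tr \<sigma>)) \<and>
     (\<forall>\<sigma> \<in> S. (\<forall>v \<in> nodes (tr \<sigma>). lab \<sigma> v \<in> S) \<and> solution P (tr \<sigma>) (lab \<sigma>)) \<and>
     (\<forall>\<sigma> \<in> S. \<forall>\<tau> \<in> S. leaf_labeled_iso (tr \<sigma>) (lab \<sigma>) (tr \<tau>) (lab \<tau>)) \<and>
     (\<forall>\<sigma> \<in> S. lab \<sigma> [] = \<sigma>)"

definition constant_certificate ::
    "'l lcl \<Rightarrow> 'l set \<Rightarrow> nat \<Rightarrow> ('l \<Rightarrow> rtree) \<Rightarrow> ('l \<Rightarrow> nat list \<Rightarrow> 'l) \<Rightarrow> 'l \<Rightarrow> 'l list \<Rightarrow> bool" where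
  "constant_certificate P S d tr lab a bs \<longleftrightarrow>
     log_star_certificate P S d tr lab \<and>
     (a, bs) \<in> configs P \<and> a \<in> set bs \<and> insert a (set bs) \<subseteq> S \<and>
     (\<exists>\<sigma> \<in> S. \<exists>v \<in> leaves (tr \<sigma>). lab \<sigma> v = a)"


section \<open>The LOCAL model\<close>

text \<open>The incident edges of a node are named \<open>Up\<close> (towards the parent) and \<open>Down i\<close>
  (towards the child number \<open>i\<close>); a node that knows its degree and whether it has a parent
  knows all its incident edges.\<close>

datatype port = Up | Down nat

record local_input =
  ident :: nat
  deg :: nat
  has_parent :: bool
  num_nodes :: nat
  max_deg :: nat

text \<open>The type parameters are the private random input of a node (\<open>unit\<close> for deterministic
  algorithms, \<open>nat \<Rightarrow> bool\<close> for randomized ones), the states, the messages and the output labels.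
  In each round a node sends a message over every incident edge and updates its state
  according to the messages it receives.\<close>

record ('r, 's, 'm, 'l) local_alg =
  start :: "local_input \<Rightarrow> 'r \<Rightarrow> 's"
  send :: "'s \<Rightarrow> port \<Rightarrow> 'm"
  receive :: "'s \<Rightarrow> (port \<Rightarrow> 'm option) \<Rightarrow> 's"
  decide :: "'s \<Rightarrow> 'l option"

text \<open>The node at the other end of an edge and its own name for that edge.\<close>

definition neighbor :: "rtree \<Rightarrow> nat list \<Rightarrow> port \<Rightarrow> (nat list \<times> port) option" where
  "neighbor t v p = (case p of
      Up \<Rightarrow> if v = [] then None else Some (butlast v, Down (last v))
    | Down i \<Rightarrow> if i < arity t v then Some (v @ [i], Up) else None)"

definition input_of :: "rtree \<Rightarrow> (nat list \<Rightarrow> nat) \<Rightarrow> nat list \<Rightarrow> local_input" where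
  "input_of t ids v = \<lparr> ident = ids v, deg = degree t v, has_parent = (v \<noteq> []),
     num_nodes = card (nodes t), max_deg = max_degree t \<rparr>"

primrec state_after :: "('r, 's, 'm, 'l) local_alg \<Rightarrow> rtree \<Rightarrow> (nat list \<Rightarrow> nat)
    \<Rightarrow> (nat list \<Rightarrow> 'r) \<Rightarrow> nat \<Rightarrow> nat list \<Rightarrow> 's" where
  "state_after A t ids rnd 0 = (\<lambda>v. start A (input_of t ids v) (rnd v))"
| "state_after A t ids rnd (Suc k) = (\<lambda>v. receive A (state_after A t ids rnd k v)
     (\<lambda>p. map_option (\<lambda>(u, p'). send A (state_after A t ids rnd k u) p') (neighbor t v p)))"

definition output_after :: "('r, 's, 'm, 'l) local_alg \<Rightarrow> rtree \<Rightarrow> (nat list \<Rightarrow> nat)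
    \<Rightarrow> (nat list \<Rightarrow> 'r) \<Rightarrow> nat \<Rightarrow> nat list \<Rightarrow> 'l option" where
  "output_after A t ids rnd k v = decide A (state_after A t ids rnd k v)"

text \<open>The first output of a node is final; the node may go on relaying messages afterwards.\<close>

definition final_label :: "('r, 's, 'm, 'l) local_alg \<Rightarrow> rtree \<Rightarrow> (nat list \<Rightarrow> nat)
    \<Rightarrow> (nat list \<Rightarrow> 'r) \<Rightarrow> nat list \<Rightarrow> 'l" where
  "final_label A t ids rnd v =
     the (output_after A t ids rnd (LEAST k. output_after A t ids rnd k v \<noteq> None) v)"

text \<open>The number of rounds until all nodes have output; it is infinite if some node never does.\<close>

definition running_time :: "('r, 's, 'm, 'l) local_alg \<Rightarrow> rtree \<Rightarrow> (nat list \<Rightarrow> nat)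
    \<Rightarrow> (nat list \<Rightarrow> 'r) \<Rightarrow> enat" where
  "running_time A t ids rnd =
     (SUP v \<in> nodes t. INF k \<in> {k. output_after A t ids rnd k v \<noteq> None}. enat k)"

definition succeeds :: "'l lcl \<Rightarrow> ('r, 's, 'm, 'l) local_alg \<Rightarrow> rtree \<Rightarrow> (nat list \<Rightarrow> nat)
    \<Rightarrow> (nat list \<Rightarrow> 'r) \<Rightarrow> bool" where
  "succeeds P A t ids rnd \<longleftrightarrow>
     (\<forall>v \<in> nodes t. \<exists>k. output_after A t ids rnd k v \<noteq> None) \<and>
     solution P t (final_label A t ids rnd)"

text \<open>Identifiers of an \<open>n\<close>-node tree come from \<open>{1..q n}\<close>.\<close>

definition valid_instance :: "(nat \<Rightarrow> nat) \<Rightarrow> nat \<Rightarrow> rtree \<Rightarrow> (nat list \<Rightarrow> nat) \<Rightarrow> bool" where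
  "valid_instance q \<delta> t ids \<longleftrightarrow>
     full_tree \<delta> t \<and> inj_on ids (nodes t) \<and> ids ` nodes t \<subseteq> {1..q (card (nodes t))}"

text \<open>For randomized algorithms the worst case is taken over the random bits as well.\<close>

definition worst_case_time ::
    "(nat \<Rightarrow> nat) \<Rightarrow> nat \<Rightarrow> ('r, 's, 'm, 'l) local_alg \<Rightarrow> nat \<Rightarrow> enat" where
  "worst_case_time q \<delta> A n =
     (SUP (t, ids, rnd) \<in> {(t, ids, rnd). valid_instance q \<delta> t ids \<and> card (nodes t) = n}.
        running_time A t ids rnd)"

definition det_solves :: "(nat \<Rightarrow> nat) \<Rightarrow> 'l lcl \<Rightarrow> (unit, 's, 'm, 'l) local_alg \<Rightarrow> bool" where
  "det_solves q P A \<longleftrightarrow>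
     (\<forall>t ids. valid_instance q (delta P) t ids \<longrightarrow> succeeds P A t ids (\<lambda>_. ()))"

definition random_bits :: "(nat \<Rightarrow> bool) measure" where
  "random_bits = (\<Pi>\<^sub>M i \<in> UNIV. measure_pmf (bernoulli_pmf (1/2)))"

definition random_input :: "rtree \<Rightarrow> (nat list \<Rightarrow> nat \<Rightarrow> bool) measure" where
  "random_input t = (\<Pi>\<^sub>M v \<in> nodes t. random_bits)"

text \<open>Outputs have to depend measurably on the random bits, so that the probability of success
  makes sense.\<close>

definition rand_solves ::
    "(nat \<Rightarrow> nat) \<Rightarrow> 'l lcl \<Rightarrow> (nat \<Rightarrow> bool, 's, 'm, 'l) local_alg \<Rightarrow> bool" where
  "rand_solves q P A \<longleftrightarrow> (\<forall>t ids. valid_instance q (delta P) t ids \<longrightarrow>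
     (\<forall>k. \<forall>v \<in> nodes t. (\<lambda>rnd. output_after A t ids rnd k v)
        \<in> measurable (random_input t) (count_space UNIV)) \<and>
     measure (random_input t) {rnd \<in> space (random_input t). succeeds P A t ids rnd}
       \<ge> 1 - 1 / real (card (nodes t)))"

text \<open>The best worst-case running time on \<open>n\<close>-node trees, infinite if no algorithm solves
  the problem. Algorithms know \<open>n\<close>, so, with a large enough state type, a single one can be
  optimal for all \<open>n\<close> at once. The
  type arguments are the types of states and messages; a statement in which they are
  type variables is about all algorithms.\<close>

definition det_complexity ::
    "'s itself \<Rightarrow> 'm itself \<Rightarrow> (nat \<Rightarrow> nat) \<Rightarrow> 'l lcl \<Rightarrow> nat \<Rightarrow> enat" where
  "det_complexity _ _ q P n =
     (INF A \<in> {A :: (unit, 's, 'm, 'l) local_alg. det_solves q P A}.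
        worst_case_time q (delta P) A n)"

definition rand_complexity ::
    "'s itself \<Rightarrow> 'm itself \<Rightarrow> (nat \<Rightarrow> nat) \<Rightarrow> 'l lcl \<Rightarrow> nat \<Rightarrow> enat" where
  "rand_complexity _ _ q P n =
     (INF A \<in> {A :: (nat \<Rightarrow> bool, 's, 'm, 'l) local_alg. rand_solves q P A}.
        worst_case_time q (delta P) A n)"


section \<open>Asymptotics\<close>

definition log_star :: "nat \<Rightarrow> nat" where
  "log_star n = (LEAST k. ((\<lambda>x. log 2 x) ^^ k) (real n) \<le> 1)"

text \<open>Only those \<open>n\<close> matter for which a full \<open>\<delta>\<close>-ary tree with \<open>n\<close> nodes exists.
  The functions compared here may take the value infinity, which the library's \<open>\<Omega>\<close> does not cover.\<close>

definition tree_sizes :: "nat \<Rightarrow> nat set" where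
  "tree_sizes \<delta> = {card (nodes t) | t. full_tree \<delta> t}"

definition Omega_on_trees :: "nat \<Rightarrow> (nat \<Rightarrow> nat) \<Rightarrow> (nat \<Rightarrow> enat) set" where
  "Omega_on_trees \<delta> g = {f. \<exists>c::real. c > 0 \<and>
     (\<forall>\<^sub>F n in sequentially. n \<in> tree_sizes \<delta> \<longrightarrow>
        ereal (c * real (g n)) \<le> ereal_of_enat (f n))}"

end

theory Submission
  imports Defs "HOL-Library.Nat_Bijection"
begin

text \<open>Suppose that an algorithm stops after \<open>T < log_star n / 4\<close> rounds on \<open>n\<close>-node trees for
  some large \<open>n\<close>. Run it in the interior of a tree whose top part is complete, where the output
  of a node depends only on the identifiers and random bits within distance \<open>T\<close>. By a union bound
  over the few placements of a small set of identifiers, the random bits can be replaced by a function of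
  the identifiers. If along the leftmost path no node ever got the label of its parent, the algorithm
  would color increasing \<open>(2T + 2)\<close>-tuples of identifiers in the sense of Linial's lower bound, which is
  impossible with so many identifiers; so from every large block of identifiers some
  parent and child get a common label \<open>a\<close>. Among growing unions of disjoint blocks, the set of labels that
  can be produced is at some point unchanged by one more block. For each such label \<open>\<sigma>\<close>, a node
  labeled \<open>\<sigma>\<close> with identifiers from the old blocks, above a layer with fixed identifiers from the
  new block that contains an \<open>a\<close>-\<open>a\<close> edge, is the root of a certificate tree. A deterministic
  algorithm is a randomized one that ignores its random bits.\<close>

section \<open>Iterated exponentials\<close>

definition iter_exp :: "nat \<Rightarrow> nat \<Rightarrow> nat" where
  "iter_exp k x = ((\<lambda>y. 2 ^ y) ^^ k) x"

lemma iter_exp_0 [simp]: "iter_exp 0 x = x"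
  by (simp add: iter_exp_def)

lemma iter_exp_Suc [simp]: "iter_exp (Suc k) x = 2 ^ iter_exp k x"
  by (simp add: iter_exp_def)

lemma iter_exp_add: "iter_exp (j + k) x = iter_exp j (iter_exp k x)"
  by (simp add: iter_exp_def funpow_add)

lemma iter_exp_ge: "x + k \<le> iter_exp k x"
proof (induction k)
  case (Suc k)
  have "iter_exp k x < 2 ^ iter_exp k x" by (rule less_exp)
  then show ?case using Suc unfolding iter_exp_Suc by linarith
qed simp

text \<open>Each exponential at least doubles a positive number. This absorbs the linear growth of
  the tree depth in \<open>T\<close>.\<close>

lemma iter_exp_ge_mult: "x * (k + 1) \<le> iter_exp k x"
proof (cases "x = 0")
  case False
  show ?thesis
  proof (induction k)
    case (Suc k)
    have *: "2 * y \<le> 2 ^ y" if "y > 0" for y :: nat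
    proof (cases y)
      case (Suc z)
      have "Suc z \<le> 2 ^ z" using less_exp[of z] by (rule Suc_leI)
      then show ?thesis using Suc by simp
    qed (use that in simp)
    have "iter_exp k x > 0" using iter_exp_ge[of x k] False by simp
    then have "2 * iter_exp k x \<le> iter_exp (Suc k) x" using * by simp
    moreover have "x * (Suc k + 1) \<le> 2 * (x * (k + 1))" by (simp add: algebra_simps)
    ultimately show ?case using Suc by linarith
  qed simp
qed simp

lemma iter_exp_mono: "x \<le> y \<Longrightarrow> iter_exp k x \<le> iter_exp k y"
  by (induction k) (auto intro: power_increasing)

lemma log_iterate_le_1:
  assumes "x \<le> real (iter_exp j 1)"
  shows "\<exists>k\<le>j. ((\<lambda>y. log 2 y) ^^ k) x \<le> 1"
  using assms
proof (induction j arbitrary: x)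
  case (Suc j)
  \<comment> \<open>Numbers up to 1 are split off, here and in the converse below, so that no
    logarithm of a nonpositive number, a default value, enters the argument.\<close>
  show ?case
  proof (cases "x \<le> 1")
    case False
    have "log 2 x \<le> log 2 (2 ^ iter_exp j 1)"
      using Suc.prems False by (intro log_mono) auto
    then have "log 2 x \<le> real (iter_exp j 1)" by simp
    from Suc.IH[OF this] obtain k where "k \<le> j" "((\<lambda>y. log 2 y) ^^ k) (log 2 x) \<le> 1" by blast
    then show ?thesis by (intro exI[of _ "Suc k"]) (simp add: funpow_swap1)
  qed (auto intro: exI[of _ 0])
qed (auto intro: exI[of _ 0])

lemma le_iter_exp:
  assumes "((\<lambda>y. log 2 y) ^^ k) x \<le> 1"
  shows "x \<le> real (iter_exp k 1)"
  using assms
proof (induction k arbitrary: x)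
  case (Suc k)
  show ?case
  proof (cases "x \<le> 1")
    case True
    then show ?thesis using iter_exp_ge[of 1 "Suc k"] by linarith
  next
    case False
    have "log 2 x \<le> real (iter_exp k 1)"
      using Suc by (simp add: funpow_swap1)
    then have "x \<le> 2 powr real (iter_exp k 1)" using False by (simp add: log_le_iff)
    then show ?thesis by (simp add: powr_realpow)
  qed
qed simp

text \<open>Translates iterated real logarithms into towers of natural numbers, in which all later
  estimates are made.\<close>

lemma log_star_le_iff: "log_star n \<le> j \<longleftrightarrow> n \<le> iter_exp j 1"
proof
  assume le: "log_star n \<le> j"
  have "real n \<le> real (iter_exp n 1)" using iter_exp_ge[of 1 n] by linarith
  then obtain k where "((\<lambda>y. log 2 y) ^^ k) (real n) \<le> 1" using log_iterate_le_1 by blast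
  then have "((\<lambda>y. log 2 y) ^^ log_star n) (real n) \<le> 1"
    unfolding log_star_def by (rule LeastI)
  then have "n \<le> iter_exp (log_star n) 1" using le_iter_exp by fastforce
  \<comment> \<open>The taller tower is the lower one with a number at least 1 in place of its top
    1.\<close>
  also have "iter_exp (log_star n) 1 \<le> iter_exp (log_star n) (iter_exp (j - log_star n) 1)"
    using iter_exp_ge[of 1 "j - log_star n"] by (intro iter_exp_mono) linarith
  also have "\<dots> = iter_exp j 1" using le by (simp flip: iter_exp_add)
  finally show "n \<le> iter_exp j 1" .
next
  assume "n \<le> iter_exp j 1"
  then obtain k where "k \<le> j" "((\<lambda>y. log 2 y) ^^ k) (real n) \<le> 1"
    using log_iterate_le_1[of "real n" j] by auto
  then show "log_star n \<le> j" unfolding log_star_def by (meson Least_le order_trans)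
qed


section \<open>Colorings of increasing tuples\<close>

text \<open>Linial's argument: passing from \<open>c\<close> to the set of colors of all one-element extensions
  shortens the tuples by one and exponentiates the number of colors.\<close>

lemma increasing_tuples_coloring_bound:
  fixes c :: "nat list \<Rightarrow> nat"
  assumes "\<And>xs. length xs = Suc r \<Longrightarrow> sorted_wrt (<) xs \<Longrightarrow> set xs \<subseteq> {..<m} \<Longrightarrow> c xs < b"
    and "\<And>xs. length xs = Suc (Suc r) \<Longrightarrow> sorted_wrt (<) xs \<Longrightarrow> set xs \<subseteq> {..<m} \<Longrightarrow>
           c (butlast xs) \<noteq> c (tl xs)"
  shows "m \<le> iter_exp r b"
  using assms
proof (induction r arbitrary: c b)
  case 0
  have "inj_on (\<lambda>x. c [x]) {..<m}"
  proof (rule linorder_inj_onI')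
    fix x y assume "x \<in> {..<m}" "y \<in> {..<m}" "x < y"
    then show "c [x] \<noteq> c [y]" using 0(2)[of "[x, y]"] by simp
  qed
  moreover have "(\<lambda>x. c [x]) ` {..<m} \<subseteq> {..<b}" using 0(1) by auto
  ultimately have "card {..<m} \<le> card {..<b}" by (rule card_inj_on_le) simp
  then show ?case by simp
next
  case (Suc r)
  define E where "E ys = {c (ys @ [y]) | y. last ys < y \<and> y < m}" for ys
  have E_sub: "E ys \<subseteq> {..<b}"
    if "length ys = Suc r" "sorted_wrt (<) ys" "set ys \<subseteq> {..<m}" for ys
  proof
    fix k assume "k \<in> E ys"
    then obtain y where y: "k = c (ys @ [y])" "last ys < y" "y < m" by (auto simp: E_def)
    have "sorted_wrt (<) (ys @ [y])"
    proof -
      have "ys = butlast ys @ [last ys]" using that(1) by (cases ys rule: rev_cases) auto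
      then have "\<forall>z\<in>set ys. z \<le> last ys"
        using that(2) by (metis Un_iff empty_iff insert_iff less_imp_le list.set(1) list.set(2)
            order_refl set_append sorted_wrt_append)
      then show ?thesis using that y by (auto simp: sorted_wrt_append)
    qed
    then show "k \<in> {..<b}" using Suc.prems(1)[of "ys @ [y]"] that y by simp
  qed
  have fin: "finite (E ys)" if "length ys = Suc r" "sorted_wrt (<) ys" "set ys \<subseteq> {..<m}" for ys
    using E_sub[OF that] finite_subset by blast
  \<comment> \<open>Subsets of \<open>{..<b}\<close> become colors below \<open>2 ^ b\<close>
    through \<open>set_encode\<close>.\<close>
  have "m \<le> iter_exp r (2 ^ b)"
  proof (rule Suc.IH[of "\<lambda>ys. set_encode (E ys)"])
    fix ys :: "nat list" assume ys: "length ys = Suc r" "sorted_wrt (<) ys" "set ys \<subseteq> {..<m}"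
    have "set_encode (E ys) \<le> set_encode {..<b}"
      using E_sub[OF ys] unfolding set_encode_def by (intro sum_mono2) auto
    also have "\<dots> < 2 ^ b"
      unfolding set_encode_def by (induction b) auto
    finally show "set_encode (E ys) < 2 ^ b" .
  next
    fix xs :: "nat list" assume xs: "length xs = Suc (Suc r)" "sorted_wrt (<) xs" "set xs \<subseteq> {..<m}"
    obtain x ys where x: "xs = x # ys" "length ys = Suc r" using xs(1) by (cases xs) auto
    then obtain zs z where z: "ys = zs @ [z]" by (cases ys rule: rev_cases) auto
    have bl: "sorted_wrt (<) (butlast xs)" "set (butlast xs) \<subseteq> {..<m}" "length (butlast xs) = Suc r"
      using xs x z by (auto simp: sorted_wrt_append)
    have t: "sorted_wrt (<) (tl xs)" "set (tl xs) \<subseteq> {..<m}" "length (tl xs) = Suc r"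
      using xs x by auto
    have lt: "last (butlast xs) < z"
      using xs(2) x z by (cases zs rule: rev_cases) (auto simp: sorted_wrt_append butlast_append)
    \<comment> \<open>The color of \<open>xs\<close> separates the two sets: it is the color of an
      extension of \<open>butlast xs\<close>, whereas as the color of some
      \<open>tl xs @ [y]\<close> it would make \<open>xs @ [y]\<close> violate the second
      hypothesis.\<close>
    have "c xs \<in> E (butlast xs)"
      using lt xs(3) x z unfolding E_def by (auto intro!: exI[of _ z])
    moreover have "c xs \<notin> E (tl xs)"
    proof
      assume "c xs \<in> E (tl xs)"
      then obtain y where y: "c xs = c (tl xs @ [y])" "last (tl xs) < y" "y < m"
        by (auto simp: E_def)
      have "\<forall>u\<in>set xs. u \<le> z" using xs(2) x z by (auto simp: sorted_wrt_append)
      then have "sorted_wrt (<) (xs @ [y])" using y xs x z by (fastforce simp: sorted_wrt_append)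
      moreover have "set (xs @ [y]) \<subseteq> {..<m}" using xs y by simp
      ultimately have "c (butlast (xs @ [y])) \<noteq> c (tl (xs @ [y]))"
        using xs(1) by (intro Suc.prems(2)) auto
      then show False using y x by simp
    qed
    ultimately show "set_encode (E (butlast xs)) \<noteq> set_encode (E (tl xs))"
      using fin bl t by (metis set_encode_eq)
  qed
  also have "\<dots> = iter_exp (Suc r) b" using iter_exp_add[of r 1 b] by simp
  finally show ?case .
qed


section \<open>Words over the child indices\<close>

text \<open>As addresses these are the nodes of the complete \<delta>-ary tree of depth
  \<open>m\<close>.\<close>

definition words :: "nat \<Rightarrow> nat \<Rightarrow> nat list set" where
  "words \<delta> m = {u. set u \<subseteq> {..<\<delta>} \<and> length u \<le> m}"

lemma words_iff: "u \<in> words \<delta> m \<longleftrightarrow> set u \<subseteq> {..<\<delta>} \<and> length u \<le> m"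
  by (simp add: words_def)

lemma finite_words [simp]: "finite (words \<delta> m)"
  unfolding words_def by (rule finite_lists_length_le) simp

lemma words_mono: "m \<le> m' \<Longrightarrow> words \<delta> m \<subseteq> words \<delta> m'"
  by (auto simp: words_iff)

lemma card_words_le: "card (words \<delta> m) \<le> (\<delta> + 1) ^ m"
proof -
  have "card (words \<delta> m) = (\<Sum>i\<le>m. \<delta> ^ i)"
    unfolding words_def by (subst card_lists_length_le) auto
  also have "\<dots> \<le> (\<delta> + 1) ^ m"
  proof (induction m)
    case (Suc m)
    have "\<delta> ^ m \<le> (\<delta> + 1) ^ m" by (rule power_mono) auto
    then have "\<delta> ^ Suc m \<le> \<delta> * (\<delta> + 1) ^ m" unfolding power_Suc by (rule mult_le_mono2)
    then have "(\<Sum>i\<le>Suc m. \<delta> ^ i) \<le> (\<delta> + 1) ^ m + \<delta> * (\<delta> + 1) ^ m"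
      unfolding sum.atMost_Suc using Suc by (rule add_mono[rotated])
    also have "\<dots> = (\<delta> + 1) ^ Suc m" by simp
    finally show ?case .
  qed simp
  finally show ?thesis .
qed

text \<open>Serves to complete partly prescribed identifiers: outside the image of \<open>A\<close>,
  at least as many values of \<open>X\<close> remain as \<open>B - A\<close> has elements.\<close>

lemma extend_injection:
  assumes "inj_on f A" "A \<subseteq> B" "finite B" "f ` A \<subseteq> X" "card B \<le> card X"
  shows "\<exists>g. inj_on g B \<and> g ` B \<subseteq> X \<and> (\<forall>x \<in> A. g x = f x)"
proof (cases "finite X")
  case True
  have "card (B - A) = card B - card A" "card (X - f ` A) = card X - card A"
    using assms True by (auto simp: card_Diff_subset finite_subset card_image)
  then have "card (B - A) \<le> card (X - f ` A)" using assms(5) by simp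
  then obtain e where e: "inj_on e (B - A)" "e ` (B - A) \<subseteq> X - f ` A"
    using assms(3) True by (metis card_le_inj finite_Diff)
  have "inj_on (\<lambda>x. if x \<in> A then f x else e x) B"
    using assms(1,2) e by (intro inj_onI) (auto split: if_splits dest: inj_onD)
  then show ?thesis
    using assms e by (intro exI[of _ "\<lambda>x. if x \<in> A then f x else e x"]) auto
next
  \<comment> \<open>For infinite \<open>X\<close> the default value \<open>card X = 0\<close> forces
    \<open>B\<close> to be empty.\<close>
  case False
  then have "B = {}" using assms(3,5) by simp
  then show ?thesis using assms by auto
qed

section \<open>Full trees with a complete top part\<close>

lemma arity_Nil: "arity t [] = length (subtrees t)"
  by (simp add: arity_def)

lemma arity_Cons: "arity t (i # v) = arity (subtrees t ! i) v"
  by (simp add: arity_def)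

lemma nodes_eq:
  "nodes t = insert [] (\<Union>i<length (subtrees t). (#) i ` nodes (subtrees t ! i))"
proof (intro set_eqI)
  fix v show "v \<in> nodes t \<longleftrightarrow> v \<in> insert [] (\<Union>i<length (subtrees t). (#) i ` nodes (subtrees t ! i))"
    by (cases v) (auto simp: nodes_def)
qed

lemma finite_nodes [simp]: "finite (nodes t)"
proof (induction t)
  case (Node ts)
  then show ?case by (subst nodes_eq) auto
qed

lemma card_nodes: "card (nodes t) = 1 + (\<Sum>s\<leftarrow>subtrees t. card (nodes s))"
proof -
  have "card (\<Union>i<length (subtrees t). (#) i ` nodes (subtrees t ! i)) =
      (\<Sum>i<length (subtrees t). card ((#) i ` nodes (subtrees t ! i)))"
    by (rule card_UN_disjoint) auto
  also have "\<dots> = (\<Sum>i<length (subtrees t). card (nodes (subtrees t ! i)))"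
    by (simp add: card_image)
  also have "\<dots> = (\<Sum>s\<leftarrow>subtrees t. card (nodes s))"
    by (simp add: sum_list_sum_nth atLeast0LessThan)
  finally show ?thesis by (subst nodes_eq) (auto simp: card_insert_if)
qed

lemma full_tree_iff:
  "full_tree \<delta> t \<longleftrightarrow>
    (length (subtrees t) = \<delta> \<or> length (subtrees t) = 0) \<and> (\<forall>s \<in> set (subtrees t). full_tree \<delta> s)"
  unfolding full_tree_def
  by (subst nodes_eq) (force simp: arity_Nil arity_Cons in_set_conv_nth)

text \<open>Every node except the root belongs to a group of \<delta> siblings.\<close>

lemma card_nodes_full_tree: "full_tree \<delta> t \<Longrightarrow> \<exists>m. card (nodes t) = 1 + \<delta> * m"
proof (induction t)
  case (Node ts)
  have full: "length ts = \<delta> \<or> length ts = 0" "\<forall>s \<in> set ts. full_tree \<delta> s"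
    using Node.prems by (auto simp: full_tree_iff[of \<delta> "Node ts"])
  then obtain m where m: "\<forall>s \<in> set ts. card (nodes s) = 1 + \<delta> * m s"
    using Node.IH by metis
  then have "(\<Sum>s\<leftarrow>ts. card (nodes s)) = (\<Sum>s\<leftarrow>ts. 1 + \<delta> * m s)"
    by (intro arg_cong[where f = sum_list] map_cong) auto
  also have "\<dots> = length ts + \<delta> * (\<Sum>s\<leftarrow>ts. m s)"
    by (induction ts) (auto simp: algebra_simps)
  also have "\<exists>k. \<dots> = \<delta> * k"
    using full(1) by (metis add_0 list.size(3) length_0_conv map_is_Nil_conv mult_0_right sum_list.Nil
        add_mult_distrib2 mult.right_neutral)
  finally show ?case by (auto simp: card_nodes[of "Node ts"])
qed

text \<open>The tree \<open>t\<close> replaces the leftmost leaf of a complete tree, so the size can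
  vary while the top \<open>d\<close> levels stay complete.\<close>

primrec complete_ext :: "nat \<Rightarrow> nat \<Rightarrow> rtree \<Rightarrow> rtree" where
  "complete_ext \<delta> 0 t = t"
| "complete_ext \<delta> (Suc d) t =
     Node (complete_ext \<delta> d t # replicate (\<delta> - 1) (complete_ext \<delta> d (Node [])))"

text \<open>Each step adds exactly \<delta> nodes, so every size congruent to 1 modulo \<delta>
  occurs.\<close>

primrec caterpillar :: "nat \<Rightarrow> nat \<Rightarrow> rtree" where
  "caterpillar \<delta> 0 = Node []"
| "caterpillar \<delta> (Suc j) = Node (caterpillar \<delta> j # replicate (\<delta> - 1) (Node []))"

lemma nth_Cons_replicate: "i < \<delta> \<Longrightarrow> (x # replicate (\<delta> - Suc 0) y) ! i = (if i = 0 then x else y)"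
  by (cases i) auto

lemma complete_ext_top:
  assumes "\<delta> \<ge> 1" "set v \<subseteq> {..<\<delta>}"
  shows "length v \<le> d \<Longrightarrow> is_node (complete_ext \<delta> d t) v"
    and "length v < d \<Longrightarrow> arity (complete_ext \<delta> d t) v = \<delta>"
  using assms(2)
proof (induction v arbitrary: d t)
  case Nil
  { case 1 show ?case by simp }
  { case 2 then show ?case using assms(1) by (cases d) (auto simp: arity_Nil) }
next
  case (Cons i v)
  { case 1 then show ?case using Cons.IH(1) by (cases d) (auto simp: nth_Cons_replicate) }
  { case 2 then show ?case using Cons.IH(2) by (cases d) (auto simp: arity_Cons nth_Cons_replicate) }
qed

lemma nodes_complete_tree:
  assumes "\<delta> \<ge> 1"
  shows "nodes (complete_ext \<delta> d (Node [])) = words \<delta> d"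
proof -
  have "is_node (complete_ext \<delta> d (Node [])) v \<longleftrightarrow> v \<in> words \<delta> d" for v
    using assms by (induction d arbitrary: v; case_tac v) (auto simp: words_iff nth_Cons_replicate)
  then show ?thesis by (auto simp: nodes_def)
qed

lemma arity_complete_tree_bottom:
  "set v \<subseteq> {..<\<delta>} \<Longrightarrow> length v = d \<Longrightarrow> arity (complete_ext \<delta> d (Node [])) v = 0"
proof (induction v arbitrary: d)
  case (Cons i v)
  then show ?case by (cases d) (auto simp: arity_Cons nth_Cons_replicate)
qed (simp add: arity_Nil)

lemma full_tree_Nil: "full_tree \<delta> (Node [])"
  by (simp add: full_tree_iff[of \<delta> "Node []"])

lemma full_tree_complete_ext: "\<delta> \<ge> 1 \<Longrightarrow> full_tree \<delta> t \<Longrightarrow> full_tree \<delta> (complete_ext \<delta> d t)"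
  by (induction d arbitrary: t) (auto simp: full_tree_iff[of \<delta> "Node (_ # _)"] full_tree_Nil)

lemma full_tree_caterpillar: "\<delta> \<ge> 1 \<Longrightarrow> full_tree \<delta> (caterpillar \<delta> j)"
  by (induction j) (auto simp: full_tree_iff[of \<delta> "Node (_ # _)"] full_tree_Nil)

lemma card_nodes_Nil: "card (nodes (Node [])) = 1"
  by (simp add: card_nodes[of "Node []"])

lemma card_nodes_caterpillar: "\<delta> \<ge> 1 \<Longrightarrow> card (nodes (caterpillar \<delta> j)) = 1 + \<delta> * j"
  by (induction j)
    (auto simp: card_nodes[of "Node (_ # _)"] card_nodes_Nil sum_list_replicate algebra_simps)

lemma card_nodes_complete_ext:
  "card (nodes (complete_ext \<delta> d t)) + 1 = card (nodes (complete_ext \<delta> d (Node []))) + card (nodes t)"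
proof (induction d arbitrary: t)
  case (Suc d)
  show ?case using Suc[of t] by (simp add: card_nodes[of "Node (_ # _)"])
qed (simp add: card_nodes_Nil)

text \<open>Both \<open>n\<close> and the size of the complete tree are 1 modulo \<delta>, so a
  caterpillar at the leftmost leaf supplies exactly the missing nodes.\<close>

lemma exists_full_tree_with_complete_top:
  assumes "\<delta> \<ge> 1" "n \<in> tree_sizes \<delta>" "card (words \<delta> d) \<le> n"
  obtains t where "full_tree \<delta> t" "card (nodes t) = n" "words \<delta> d \<subseteq> nodes t"
    "\<And>v. v \<in> words \<delta> d \<Longrightarrow> length v < d \<Longrightarrow> arity t v = \<delta>"
proof -
  let ?c = "complete_ext \<delta> d (Node [])"
  obtain m where m: "n = 1 + \<delta> * m" using assms(2) card_nodes_full_tree unfolding tree_sizes_def by blast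
  have card_c: "card (nodes ?c) = card (words \<delta> d)" using assms(1) by (simp add: nodes_complete_tree)
  obtain m' where m': "card (nodes ?c) = 1 + \<delta> * m'"
    using card_nodes_full_tree[OF full_tree_complete_ext[OF assms(1) full_tree_Nil]] by blast
  have "m' \<le> m" using m m' card_c assms(1,3) by simp
  let ?t = "complete_ext \<delta> d (caterpillar \<delta> (m - m'))"
  have "card (nodes ?t) = n"
    using card_nodes_complete_ext[of \<delta> d "caterpillar \<delta> (m - m')"] m m' \<open>m' \<le> m\<close> assms(1)
    by (simp add: card_nodes_caterpillar flip: add_mult_distrib2)
  moreover have "full_tree \<delta> ?t" using assms(1) by (intro full_tree_complete_ext full_tree_caterpillar)
  ultimately show ?thesis
    using complete_ext_top[OF assms(1), where t = "caterpillar \<delta> (m - m')"] that[of ?t]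
    by (auto simp: words_iff nodes_def subset_iff)
qed

section \<open>From local labelings to certificates\<close>

text \<open>\<open>out h v\<close> is the output of a \<open>T\<close>-round algorithm at the node \<open>v\<close>
  when the nodes have the identifiers \<open>h\<close>.\<close>

locale local_labeling =
  fixes P :: "'l lcl" and T :: nat and K :: "nat set"
    and out :: "(nat list \<Rightarrow> nat) \<Rightarrow> nat list \<Rightarrow> 'l"
  assumes lcl: "lcl_problem P"
    and shift: "\<And>a a' w h h'. T < length w \<Longrightarrow> set w \<subseteq> {..<delta P} \<Longrightarrow>
        (\<And>u. u \<in> words (delta P) (length w + T) \<Longrightarrow> h (a @ u) = h' (a' @ u)) \<Longrightarrow>
        out h (a @ w) = out h' (a' @ w)"
    and valid: "\<And>h v. inj_on h (words (delta P) (4 * T + 4)) \<Longrightarrow>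
        h ` words (delta P) (4 * T + 4) \<subseteq> K \<Longrightarrow> set v \<subseteq> {..<delta P} \<Longrightarrow>
        T < length v \<Longrightarrow> length v + T < 4 * T + 4 \<Longrightarrow>
        out h v \<in> labels P \<and> (\<exists>\<rho>. \<rho> permutes {..<delta P} \<and>
          (out h v, map (\<lambda>i. out h (v @ [\<rho> i])) [0..<delta P]) \<in> configs P)"
begin

abbreviation "W \<equiv> words (delta P)"

abbreviation "D \<equiv> 4 * T + 4"

text \<open>The word \<open>w\<close> is the shortest for which \<open>shift\<close> applies, and
  its \<open>T\<close>-neighborhood lies in \<open>W (2 * T + 1)\<close>. By \<open>shift\<close>
  these are the labels of arbitrary nodes deeper than \<open>T\<close> when the identifiers come
  from \<open>X\<close>.\<close>

definition producible :: "nat set \<Rightarrow> 'l set" where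
  "producible X = {out h w | h w. set w \<subseteq> {..<delta P} \<and> length w = Suc T \<and>
     inj_on h (W (2 * T + 1)) \<and> h ` W (2 * T + 1) \<subseteq> X}"

lemma producible_mono: "X \<subseteq> Y \<Longrightarrow> producible X \<subseteq> producible Y"
  unfolding producible_def by blast

lemma delta_pos: "delta P \<ge> 1"
  using lcl by (simp add: lcl_problem_def)

text \<open>The assumption \<open>valid\<close> concerns assignments on all of \<open>W D\<close>;
  \<open>h\<close> is therefore extended injectively within \<open>X\<close>, and by
  \<open>shift\<close> this preserves the output.\<close>

lemma producible_subset_labels:
  assumes "X \<subseteq> K" "card (W D) \<le> card X"
  shows "producible X \<subseteq> labels P"
proof
  fix a assume "a \<in> producible X"
  then obtain h w where hw: "a = out h w" "set w \<subseteq> {..<delta P}" "length w = Suc T"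
    "inj_on h (W (2 * T + 1))" "h ` W (2 * T + 1) \<subseteq> X" unfolding producible_def by blast
  have "W (2 * T + 1) \<subseteq> W D" by (rule words_mono) simp
  from extend_injection[OF hw(4) this finite_words hw(5) assms(2)]
  obtain g where g: "inj_on g (W D)" "g ` W D \<subseteq> X" "\<And>u. u \<in> W (2 * T + 1) \<Longrightarrow> g u = h u"
    by blast
  have "out h ([] @ w) = out g ([] @ w)" using hw g by (intro shift) (auto simp: mult_2)
  then show "a \<in> labels P" using valid[OF g(1) _ hw(2)] g(2) assms(1) hw(1,3) by auto
qed

text \<open>Re-rooting at the ancestor \<open>T + 1\<close> levels above \<open>v\<close> keeps the
  output, and the words of length up to \<open>2 * T + 1\<close> below that ancestor stay within
  depth \<open>D\<close>.\<close>

lemma out_producible: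
  assumes "inj_on h (W D)" "h ` W D \<subseteq> X" "set v \<subseteq> {..<delta P}" "T < length v" "length v + T \<le> D"
  shows "out h v \<in> producible X"
proof -
  let ?a = "take (length v - Suc T) v" and ?w = "drop (length v - Suc T) v"
  have len: "length ?w = Suc T" "length ?a = length v - Suc T" using assms(4) by auto
  have set_w: "set ?w \<subseteq> {..<delta P}" "set ?a \<subseteq> {..<delta P}"
    using assms(3) by (meson order_trans set_drop_subset set_take_subset)+
  have W: "?a @ u \<in> W D" if "u \<in> W (2 * T + 1)" for u
    using that set_w len assms(4,5) by (auto simp: words_iff)
  have "out h (?a @ ?w) = out (\<lambda>u. h (?a @ u)) ([] @ ?w)"
    by (rule shift) (use len set_w in auto)
  then have "out h v = out (\<lambda>u. h (?a @ u)) ?w" by simp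
  moreover have "inj_on (\<lambda>u. h (?a @ u)) (W (2 * T + 1))"
    using assms(1) W by (intro inj_onI) (metis inj_onD same_append_eq)
  moreover have "(\<lambda>u. h (?a @ u)) ` W (2 * T + 1) \<subseteq> X" using W assms(2) by blast
  ultimately show ?thesis using len(1) set_w(1) unfolding producible_def by blast
qed

text \<open>Along the leftmost path, a labeling without monochromatic edges would color the increasing
  tuples of identifier blocks, which Linial's bound forbids.\<close>

lemma monochromatic_edge:
  assumes X: "X \<subseteq> K" "finite X" "card (W D) \<le> card X" "m * card (W (2 * T + 2)) \<le> card X"
    and m: "iter_exp (2 * T + 1) (card (labels P)) < m"
  obtains h where "inj_on h (W (2 * T + 2))" "h ` W (2 * T + 2) \<subseteq> X"
    "out h (replicate (Suc T) 0) = out h (0 # replicate (Suc T) 0)"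
proof (rule ccontr)
  assume no: "\<not> thesis"
  let ?z = "replicate (Suc T) (0::nat)"
  have z: "set ?z \<subseteq> {..<delta P}" using delta_pos by auto
  \<comment> \<open>The set \<open>X\<close> contains \<open>m\<close> disjoint blocks of
    identifiers, each large enough for \<open>W (2 * T + 2)\<close>.\<close>
  obtain e where e: "inj_on e ({..<m} \<times> W (2 * T + 2))" "e ` ({..<m} \<times> W (2 * T + 2)) \<subseteq> X"
    using card_le_inj[of "{..<m} \<times> W (2 * T + 2)" X] X by (auto simp: card_cartesian_product)
  \<comment> \<open>A node that leaves the leftmost path at depth \<open>j\<close> gets its
    identifier from the block \<open>xs ! j\<close>, at the position given by the rest of its
    address. Moving down this path thus amounts to dropping the first block.\<close>
  define H where
    "H xs v = e (xs ! length (takeWhile (\<lambda>i. i = 0) v), dropWhile (\<lambda>i. i = 0) v)"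
    for xs :: "nat list" and v
  have split: "u = v" if "length (takeWhile (\<lambda>i. i = 0) u) = length (takeWhile (\<lambda>i. i = 0) v)"
      "dropWhile (\<lambda>i. i = 0) u = dropWhile (\<lambda>i. i = 0) v" for u v :: "nat list"
  proof -
    have "takeWhile (\<lambda>i. i = 0) x = replicate (length (takeWhile (\<lambda>i. i = 0) x)) 0" for x :: "nat list"
      by (metis (mono_tags, lifting) replicate_length_same set_takeWhileD)
    then show ?thesis using that by (metis takeWhile_dropWhile_id)
  qed
  \<comment> \<open>Depths 0 to \<open>k\<close> need \<open>k + 1\<close> blocks. Below,
    \<open>k = 2 * T + 1\<close> gives the colored tuples and \<open>k = 2 * T + 2\<close> the
    tuples that describe an edge.\<close>
  have H: "inj_on (H xs) (W k)" "H xs ` W k \<subseteq> X"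
    if "length xs = Suc k" "sorted_wrt (<) xs" "set xs \<subseteq> {..<m}" "k \<le> 2 * T + 2" for xs k
  proof -
    have dom: "(xs ! length (takeWhile (\<lambda>i. i = 0) v), dropWhile (\<lambda>i. i = 0) v)
        \<in> {..<m} \<times> W (2 * T + 2)" "length (takeWhile (\<lambda>i. i = 0) v) < length xs" if "v \<in> W k" for v
    proof -
      have "length (takeWhile (\<lambda>i. i = 0) v) \<le> length v" "length (dropWhile (\<lambda>i. i = 0) v) \<le> length v"
        by (rule length_takeWhile_le length_dropWhile_le)+
      then show "length (takeWhile (\<lambda>i. i = 0) v) < length xs"
        using \<open>length xs = Suc k\<close> that unfolding words_iff by linarith
      moreover have "set (dropWhile (\<lambda>i. i = 0) v) \<subseteq> {..<delta P}"
        using that by (auto simp: words_iff dest: set_dropWhileD)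
      moreover have "length (dropWhile (\<lambda>i. i = 0) v) \<le> 2 * T + 2"
        using \<open>length (dropWhile (\<lambda>i. i = 0) v) \<le> length v\<close> \<open>k \<le> 2 * T + 2\<close> that
        unfolding words_iff by linarith
      moreover have "xs ! length (takeWhile (\<lambda>i. i = 0) v) < m"
        using \<open>set xs \<subseteq> {..<m}\<close> nth_mem[OF \<open>length (takeWhile (\<lambda>i. i = 0) v) < length xs\<close>] by blast
      ultimately show "(xs ! length (takeWhile (\<lambda>i. i = 0) v), dropWhile (\<lambda>i. i = 0) v)
        \<in> {..<m} \<times> W (2 * T + 2)"
        by (simp add: words_iff)
    qed
    have "distinct xs" using that(2) by (simp add: strict_sorted_iff)
    show "inj_on (H xs) (W k)"
    proof (rule inj_onI)
      fix u v assume uv: "u \<in> W k" "v \<in> W k" "H xs u = H xs v"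
      then have "xs ! length (takeWhile (\<lambda>i. i = 0) u) = xs ! length (takeWhile (\<lambda>i. i = 0) v)"
        "dropWhile (\<lambda>i. i = 0) u = dropWhile (\<lambda>i. i = 0) v"
        using inj_onD[OF e(1) _ dom(1)[OF uv(1)] dom(1)[OF uv(2)]] unfolding H_def by blast+
      moreover from this(1)
      have "length (takeWhile (\<lambda>i. i = 0) u) = length (takeWhile (\<lambda>i. i = 0) v)"
        using nth_eq_iff_index_eq[OF \<open>distinct xs\<close>] dom(2) uv(1,2) by blast
      ultimately show "u = v" using split by blast
    qed
    show "H xs ` W k \<subseteq> X" using dom(1) e(2) unfolding H_def by blast
  qed
  have prod: "out (H xs) ?z \<in> labels P"
    if "length xs = 2 * T + 2" "sorted_wrt (<) xs" "set xs \<subseteq> {..<m}" for xs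
  proof -
    have "out (H xs) ?z \<in> producible X"
      unfolding producible_def using H[of xs "2 * T + 1"] that z
      by (intro CollectI exI[of _ "H xs"] exI[of _ ?z]) simp
    then show ?thesis using producible_subset_labels X by blast
  qed
  have "finite (labels P)" using lcl by (simp add: lcl_problem_def)
  then obtain code where code: "bij_betw code (labels P) {0..<card (labels P)}"
    using ex_bij_betw_finite_nat by blast
  have "m \<le> iter_exp (2 * T + 1) (card (labels P))"
  proof (rule increasing_tuples_coloring_bound[where c = "\<lambda>xs. code (out (H xs) ?z)"])
    fix xs :: "nat list"
    assume "length xs = Suc (2 * T + 1)" "sorted_wrt (<) xs" "set xs \<subseteq> {..<m}"
    then show "code (out (H xs) ?z) < card (labels P)"
      using prod bij_betwE[OF code] by fastforce
  next
    fix xs :: "nat list"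
    assume xs: "length xs = Suc (Suc (2 * T + 1))" "sorted_wrt (<) xs" "set xs \<subseteq> {..<m}"
    have s: "sorted_wrt (<) (butlast xs)" "sorted_wrt (<) (tl xs)"
      using xs(2) sorted_wrt_append[of "(<)" "butlast xs" "[last xs]"]
      by (cases "xs = []", simp_all) (cases xs, simp_all)
    have ss: "set (butlast xs) \<subseteq> {..<m}" "set (tl xs) \<subseteq> {..<m}"
      using xs(3) in_set_butlastD[of _ xs] list.set_sel(2)[of xs] xs(1) by fastforce+
    have len: "length (takeWhile (\<lambda>i. i = 0) u) \<le> length u" for u :: "nat list"
      by (rule length_takeWhile_le)
    \<comment> \<open>The output at \<open>?z\<close> depends on depths up to
      \<open>2 * T + 1\<close> only, hence not on the last block.\<close>
    have "out (H (butlast xs)) ([] @ ?z) = out (H xs) ([] @ ?z)"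
    proof (rule shift)
      fix u assume "u \<in> W (length ?z + T)"
      then have "length (takeWhile (\<lambda>i. i = 0) u) < length (butlast xs)"
        using len[of u] xs(1) by (auto simp: words_iff)
      then show "H (butlast xs) ([] @ u) = H xs ([] @ u)" by (simp add: H_def nth_butlast)
    qed (use z in auto)
    moreover have "out (H (tl xs)) ([] @ ?z) = out (H xs) ([0] @ ?z)"
    proof (rule shift)
      fix u assume "u \<in> W (length ?z + T)"
      then have "length (takeWhile (\<lambda>i. i = 0) u) < length (tl xs)"
        using len[of u] xs(1) by (auto simp: words_iff)
      then show "H (tl xs) ([] @ u) = H xs ([0] @ u)" by (simp add: H_def nth_tl)
    qed (use z in auto)
    moreover have "out (H xs) ?z \<noteq> out (H xs) (0 # ?z)"
      using no that[of "H xs"] H[of xs "2 * T + 2"] xs by (metis Suc_1 add_Suc_right mult_2 order_refl add_2_eq_Suc')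
    ultimately have "out (H (butlast xs)) ?z \<noteq> out (H (tl xs)) ?z" by simp
    moreover have "out (H (butlast xs)) ?z \<in> labels P" "out (H (tl xs)) ?z \<in> labels P"
      using prod[of "butlast xs"] prod[of "tl xs"] xs(1) s ss by simp_all
    ultimately show "code (out (H (butlast xs)) ?z) \<noteq> code (out (H (tl xs)) ?z)"
      using code by (auto simp: bij_betw_def dest: inj_onD)
  qed
  then show False using m by simp
qed

text \<open>The roots of the certificate trees and their \<open>T\<close>-neighborhoods get identifiers from \<open>Y\<close>, the
  layers that determine the leaf labels get a fixed assignment \<open>G\<close> from \<open>X\<close> that has a
  monochromatic edge at a leaf. Stability puts all labels of the trees back into \<open>producible Y\<close>.\<close>

lemma certificate_if_stable:
  assumes YZ: "Y \<subseteq> Z" "X \<subseteq> Z - Y" "Z \<subseteq> K" "finite Z" "producible Z = producible Y"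
    and X: "card (W D) \<le> card X" "m * card (W (2 * T + 2)) \<le> card X"
    and m: "iter_exp (2 * T + 1) (card (labels P)) < m"
  shows "\<exists>S d tr lab a bs. constant_certificate P S d tr lab a bs"
proof -
  let ?z = "replicate (Suc T) (0::nat)"
  have z: "set ?z \<subseteq> {..<delta P}" using delta_pos by auto
  note replicate_Suc [simp del]
  have fX: "X \<subseteq> K" "finite X" "X \<subseteq> Z" using YZ by (auto intro: finite_subset)
  have cardZ: "card (W D) \<le> card Z" using X(1) card_mono[OF YZ(4) fX(3)] by simp
  obtain e where e: "inj_on e (W (2 * T + 2))" "e ` W (2 * T + 2) \<subseteq> X"
    "out e ?z = out e (0 # ?z)"
    by (rule monochromatic_edge[OF fX(1,2) X m])
  \<comment> \<open>Below \<open>?z\<close> the assignment \<open>G\<close> copies \<open>e\<close>,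
    which puts the upper end of the monochromatic edge at depth \<open>2 * T + 2\<close>, the leaf
    level of the certificate trees.\<close>
  have "inj_on (\<lambda>v. e (drop (Suc T) v)) ((\<lambda>u. ?z @ u) ` W (2 * T + 2))"
    using e(1) by (auto simp: inj_on_def)
  moreover have "(\<lambda>u. ?z @ u) ` W (2 * T + 2) \<subseteq> W D"
    using z by (auto simp: words_iff)
  moreover have "(\<lambda>v. e (drop (Suc T) v)) ` ((\<lambda>u. ?z @ u) ` W (2 * T + 2)) \<subseteq> X"
    using e(2) by auto
  ultimately have "\<exists>G. inj_on G (W D) \<and> G ` W D \<subseteq> X \<and>
      (\<forall>v \<in> (\<lambda>u. ?z @ u) ` W (2 * T + 2). G v = e (drop (Suc T) v))"
    by (rule extend_injection[OF _ _ finite_words _ X(1)])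
  then obtain G where G: "inj_on G (W D)" "G ` W D \<subseteq> X"
    and "\<forall>v \<in> (\<lambda>u. ?z @ u) ` W (2 * T + 2). G v = e (drop (Suc T) v)"
    by blast
  then have G_eq: "G (?z @ u) = e u" if "u \<in> W (2 * T + 2)" for u using that by auto

  \<comment> \<open>The node \<open>w\<close> becomes the root of the tree for \<sigma>; from depth
    \<open>T + 1\<close> below it on, the identifiers are those of \<open>G\<close>, the same for
    all \<sigma>.\<close>
  have "\<exists>H w. set w \<subseteq> {..<delta P} \<and> length w = Suc T \<and> inj_on H (W D) \<and> H ` W D \<subseteq> Z \<and>
      out H w = \<sigma> \<and> (\<forall>u \<in> W (3 * T + 3). T < length u \<longrightarrow> H (w @ u) = G u)"
    if sigma: "\<sigma> \<in> producible Z" for \<sigma>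
  proof -
    obtain h w where hw: "\<sigma> = out h w" "set w \<subseteq> {..<delta P}" "length w = Suc T"
      "inj_on h (W (2 * T + 1))" "h ` W (2 * T + 1) \<subseteq> Y"
      \<comment> \<open>Stability realizes \<sigma> with identifiers from \<open>Y\<close>, which
        are disjoint from those of \<open>G\<close>.\<close>
      using sigma unfolding YZ(5) unfolding producible_def by blast
    \<comment> \<open>Nodes \<open>w @ u\<close> with \<open>u\<close> in \<open>B\<close> have
      depth at least \<open>2 * T + 2\<close>, just outside the words on which \<open>h\<close> is
      prescribed.\<close>
    define B where "B = {u \<in> W (3 * T + 3). T < length u}"
    define A where "A = W (2 * T + 1) \<union> (\<lambda>u. w @ u) ` B"
    define f where "f v = (if length v \<le> 2 * T + 1 then h v else G (drop (Suc T) v))" for v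
    have f1: "f v = h v" if "v \<in> W (2 * T + 1)" for v using that by (simp add: f_def words_iff)
    have f2: "f (w @ u) = G u" if "u \<in> B" for u using that hw(3) by (simp add: f_def B_def)
    have B_sub: "B \<subseteq> W D" unfolding B_def words_def by auto
    have "inj_on f (W (2 * T + 1))" using hw(4) inj_on_cong[of "W (2 * T + 1)" f h, OF f1] by simp
    moreover have "inj_on f ((\<lambda>u. w @ u) ` B)"
    proof (rule inj_on_imageI)
      have "inj_on (f \<circ> (@) w) B \<longleftrightarrow> inj_on G B" using f2 by (intro inj_on_cong) simp
      then show "inj_on (f \<circ> (@) w) B" using inj_on_subset[OF G(1) B_sub] by blast
    qed
    moreover have f_im: "f ` W (2 * T + 1) \<subseteq> Y" "f ` (\<lambda>u. w @ u) ` B \<subseteq> X"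
    proof -
      show "f ` W (2 * T + 1) \<subseteq> Y" using hw(5) f1 by (simp add: image_subset_iff)
      show "f ` (\<lambda>u. w @ u) ` B \<subseteq> X" using G(2) B_sub f2 by auto
    qed
    ultimately have "inj_on f A"
      unfolding A_def inj_on_Un using YZ(2) by blast
    moreover have "A \<subseteq> W D"
      unfolding A_def B_def using hw(2,3) by (auto simp: words_iff)
    moreover have "f ` A \<subseteq> Z" using f_im YZ(1) fX(3) unfolding A_def image_Un by blast
    ultimately have "\<exists>H. inj_on H (W D) \<and> H ` W D \<subseteq> Z \<and> (\<forall>v \<in> A. H v = f v)"
      by (rule extend_injection[OF _ _ finite_words _ cardZ])
    then obtain H where H: "inj_on H (W D)" "H ` W D \<subseteq> Z" "\<And>v. v \<in> A \<Longrightarrow> H v = f v"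
      by blast
    have "out H ([] @ w) = out h ([] @ w)"
      using hw(2,3) H(3) f1 by (intro shift) (auto simp: A_def mult_2)
    moreover have "H (w @ u) = G u" if "u \<in> W (3 * T + 3)" "T < length u" for u
      using that H(3)[of "w @ u"] f2[of u] by (simp add: A_def B_def)
    ultimately show ?thesis using H(1,2) hw(1-3) by auto
  qed
  then obtain H w where Hw: "\<And>\<sigma>. \<sigma> \<in> producible Z \<Longrightarrow> set (w \<sigma>) \<subseteq> {..<delta P} \<and>
      length (w \<sigma>) = Suc T \<and> inj_on (H \<sigma>) (W D) \<and> H \<sigma> ` W D \<subseteq> Z \<and> out (H \<sigma>) (w \<sigma>) = \<sigma> \<and>
      (\<forall>u \<in> W (3 * T + 3). T < length u \<longrightarrow> H \<sigma> (w \<sigma> @ u) = G u)"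
    by metis

  \<comment> \<open>Leaf outputs then depend only on nodes at least \<open>T + 1\<close> levels
    below the root \<open>w \<sigma>\<close>, where \<open>G\<close> rules, and
    \<open>(T + 1) + d + T < D\<close> leaves room for the neighborhoods of the leaves.\<close>
  define d where "d = 2 * T + 2"
  define t where "t = complete_ext (delta P) d (Node [])"
  define lab where "lab \<sigma> u = out (H \<sigma>) (w \<sigma> @ u)" for \<sigma> u
  have nodes_t: "nodes t = W d" unfolding t_def by (rule nodes_complete_tree[OF delta_pos])
  have arity_t: "arity t u = (if length u < d then delta P else 0)" if "u \<in> W d" for u
    using that complete_ext_top(2)[OF delta_pos, of u d] arity_complete_tree_bottom[of u "delta P" d]
    unfolding t_def words_iff by auto
  have leaves_t: "leaves t = {u \<in> W d. length u = d}"
    using delta_pos arity_t nodes_t unfolding leaves_def by (auto simp: words_iff split: if_splits)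
  have complete: "complete_tree (delta P) d t"
    unfolding complete_tree_def leaves_t nodes_t using arity_t by (auto simp: words_iff)

  have lab_in: "lab \<sigma> u \<in> producible Z" if "\<sigma> \<in> producible Z" "u \<in> W d" for \<sigma> u
    unfolding lab_def using Hw[OF that(1)] that(2)
    by (intro out_producible) (auto simp: d_def words_iff)
  have labels: "producible Z \<subseteq> labels P" by (rule producible_subset_labels[OF YZ(3) cardZ])
  have sol: "solution P t (lab \<sigma>)" if "\<sigma> \<in> producible Z" for \<sigma>
    unfolding solution_def nodes_t
  proof (intro conjI ballI impI)
    fix u assume u: "u \<in> W d" "arity t u = delta P"
    then have len: "length u < d" using arity_t delta_pos by (metis not_one_le_zero)
    have "H \<sigma> ` W D \<subseteq> K" using Hw[OF that] YZ(3) by blast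
    then show "\<exists>\<rho>. \<rho> permutes {..<delta P} \<and>
        (lab \<sigma> u, map (\<lambda>i. lab \<sigma> (u @ [\<rho> i])) [0..<delta P]) \<in> configs P"
      using valid[of "H \<sigma>" "w \<sigma> @ u"] Hw[OF that] u(1) len
      unfolding lab_def d_def words_iff by simp
  qed (use lab_in[OF that] labels in blast)

  \<comment> \<open>The right-hand side does not mention \<sigma>, so the identity is an isomorphism
    respecting the leaf labels.\<close>
  have leaf: "lab \<sigma> u = out G u" if sigma: "\<sigma> \<in> producible Z" and u: "u \<in> leaves t" for \<sigma> u
  proof -
    let ?p = "take (Suc T) u" and ?s = "drop (Suc T) u"
    have len: "length ?p = Suc T" "length ?s = Suc T" using u unfolding leaves_t d_def by auto
    have sub: "set ?p \<subseteq> {..<delta P}" "set ?s \<subseteq> {..<delta P}"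
      using u set_take_subset[of "Suc T" u] set_drop_subset[of "Suc T" u]
      unfolding leaves_t words_iff by auto
    have "out (H \<sigma>) ((w \<sigma> @ ?p) @ ?s) = out G (?p @ ?s)"
    proof (rule shift)
      fix x assume "x \<in> W (length ?s + T)"
      then have "?p @ x \<in> W (3 * T + 3)" "T < length (?p @ x)" using sub len by (auto simp: words_iff)
      then show "H \<sigma> ((w \<sigma> @ ?p) @ x) = G (?p @ x)" using Hw[OF sigma] by simp
    qed (use len sub in auto)
    then show ?thesis by (simp add: lab_def)
  qed
  have iso: "leaf_labeled_iso t (lab \<sigma>) t (lab \<tau>)" if "\<sigma> \<in> producible Z" "\<tau> \<in> producible Z" for \<sigma> \<tau>
    unfolding leaf_labeled_iso_def using that leaf by (intro exI[of _ id]) auto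

  \<comment> \<open>Under \<open>G\<close>, the leaf \<open>?z @ ?z\<close> and its child number 0,
    one level below the certificate tree, both get this label. The special configuration is the one
    around this leaf.\<close>
  let ?a = "out e ?z"
  have G_e: "out G (?z @ v) = out e v" if "set v \<subseteq> {..<delta P}" "T < length v" "length v \<le> T + 2" for v
  proof -
    have "out G (?z @ v) = out e ([] @ v)"
    proof (rule shift)
      fix x assume "x \<in> W (length v + T)"
      then have "x \<in> W (2 * T + 2)" using that(3) by (auto simp: words_iff)
      then show "G (?z @ x) = e ([] @ x)" by (simp add: G_eq)
    qed (use that in auto)
    then show ?thesis by simp
  qed
  have G_zz: "out G (?z @ ?z) = ?a" using z by (intro G_e) auto
  have "out G (?z @ (?z @ [0])) = out e (?z @ [0])" using z delta_pos by (intro G_e) auto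
  then have G_zz0: "out G ((?z @ ?z) @ [0]) = ?a"
    using e(3) by (simp add: replicate_append_same)
  have prod_G: "out G v \<in> producible Z" if "set v \<subseteq> {..<delta P}" "T < length v" "length v + T \<le> D" for v
    using out_producible[OF G that] producible_mono[OF fX(3)] by blast
  obtain \<rho> where \<rho>: "\<rho> permutes {..<delta P}"
    "(out G (?z @ ?z), map (\<lambda>i. out G ((?z @ ?z) @ [\<rho> i])) [0..<delta P]) \<in> configs P"
    using valid[of G "?z @ ?z"] G z fX(1) by auto
  define bs where "bs = map (\<lambda>i. out G ((?z @ ?z) @ [\<rho> i])) [0..<delta P]"
  have "(?a, bs) \<in> configs P" using \<rho>(2) G_zz bs_def by simp
  moreover have "?a \<in> set bs"
  proof -
    \<comment> \<open>Since \<rho> is onto, the child number 0 is among the permuted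
      children.\<close>
    have "0 \<in> \<rho> ` {..<delta P}" using permutes_image[OF \<rho>(1)] delta_pos by simp
    then obtain i where i: "i < delta P" "\<rho> i = 0" by auto
    then have "?a = (\<lambda>i. out G ((?z @ ?z) @ [\<rho> i])) i" using G_zz0 by simp
    then show ?thesis unfolding bs_def set_map using i(1) by (intro image_eqI) auto
  qed
  moreover have a_in: "?a \<in> producible Z"
    using prod_G[of "?z @ ?z"] G_zz z by simp
  moreover have "set bs \<subseteq> producible Z"
  proof
    fix b assume "b \<in> set bs"
    then obtain i where i: "i < delta P" "b = out G ((?z @ ?z) @ [\<rho> i])" unfolding bs_def by auto
    have "\<rho> i < delta P" using permutes_in_image[OF \<rho>(1)] i(1) by simp
    then show "b \<in> producible Z" unfolding i(2) using z by (intro prod_G) auto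
  qed
  moreover have "?z @ ?z \<in> leaves t" using z unfolding leaves_t d_def words_iff by auto
  moreover have "lab ?a (?z @ ?z) = ?a" using leaf[OF a_in \<open>?z @ ?z \<in> leaves t\<close>] G_zz by simp
  moreover have "log_star_certificate P (producible Z) d (\<lambda>_. t) lab"
    unfolding log_star_certificate_def
    using a_in labels complete lab_in sol iso nodes_t Hw by (auto simp: d_def lab_def)
  ultimately have "constant_certificate P (producible Z) d (\<lambda>_. t) lab ?a bs"
    unfolding constant_certificate_def by blast
  then show ?thesis by blast
qed

text \<open>Pigeonhole: if the producible labels grew strictly at each of
  \<open>card (labels P) + 1\<close> steps, there would be too many of them. At a step without
  growth the \<open>k\<close> new identifiers form the set \<open>X\<close>.\<close>

lemma exists_constant_certificate:
  assumes K: "{1..(card (labels P) + 1) * k} \<subseteq> K"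
    and k: "card (W D) \<le> k" "m * card (W (2 * T + 2)) \<le> k"
    and m: "iter_exp (2 * T + 1) (card (labels P)) < m"
  shows "\<exists>S d tr lab a bs. constant_certificate P S d tr lab a bs"
proof -
  define Y where "Y j = {1..j * k}" for j
  have YK: "Y j \<subseteq> K" if "j \<le> card (labels P) + 1" for j
  proof -
    have "j * k \<le> (card (labels P) + 1) * k" using that by (rule mult_le_mono1)
    then show ?thesis using K unfolding Y_def by auto
  qed
  have mono: "Y j \<subseteq> Y (Suc j)" for j unfolding Y_def by auto
  have fin: "finite (labels P)" using lcl by (simp add: lcl_problem_def)
  have "\<exists>j \<le> card (labels P). producible (Y (Suc j)) = producible (Y j)"
  proof (rule ccontr)
    assume "\<not> ?thesis"
    then have strict: "producible (Y j) \<subset> producible (Y (Suc j))" if "j \<le> card (labels P)" for j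
      using that producible_mono[OF mono[of j]] by blast
    have sub: "producible (Y (Suc j)) \<subseteq> labels P" if "j \<le> card (labels P)" for j
      using that k(1) by (intro producible_subset_labels YK) (auto simp: Y_def)
    have "j \<le> card (producible (Y j))" if "j \<le> card (labels P) + 1" for j
      using that
    proof (induction j)
      case (Suc j)
      have "card (producible (Y j)) < card (producible (Y (Suc j)))"
        using Suc.prems strict[of j] sub[of j] fin by (intro psubset_card_mono) (auto intro: finite_subset)
      then show ?case using Suc by simp
    qed simp
    from this[of "card (labels P) + 1"] show False
      using card_mono[OF fin sub[of "card (labels P)"]] by simp
  qed
  then obtain j where j: "j \<le> card (labels P)" "producible (Y (Suc j)) = producible (Y j)" by blast
  have "card (Y (Suc j) - Y j) = k"
    using card_Diff_subset[OF _ mono[of j]] by (simp add: Y_def)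
  then show ?thesis
    using k YK[of "Suc j"] j mono[of j] m
    by (intro certificate_if_stable[of "Y j" "Y (Suc j)" "Y (Suc j) - Y j" m]) (auto simp: Y_def)
qed

end

section \<open>Executions in the interior of a tree\<close>

text \<open>The state of the node \<open>v\<close> after \<open>k\<close> rounds, where every node has a parent and
  \<open>\<delta>\<close> children, and \<open>g u\<close> consists of the identifier and the random input of \<open>u\<close>.
  The values are meaningless for \<open>k \<ge> length v\<close>, since \<open>butlast [] = []\<close>.\<close>

primrec interior_state ::
    "('r, 's, 'm, 'l) local_alg \<Rightarrow> nat \<Rightarrow> (nat \<Rightarrow> local_input) \<Rightarrow> (nat list \<Rightarrow> nat \<times> 'r) \<Rightarrow>
      nat \<Rightarrow> nat list \<Rightarrow> 's" where
  "interior_state A \<delta> inp g 0 = (\<lambda>v. start A (inp (fst (g v))) (snd (g v)))"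
| "interior_state A \<delta> inp g (Suc k) = (\<lambda>v. receive A (interior_state A \<delta> inp g k v)
     (\<lambda>p. case p of
        Up \<Rightarrow> Some (send A (interior_state A \<delta> inp g k (butlast v)) (Down (last v)))
      | Down i \<Rightarrow> if i < \<delta> then Some (send A (interior_state A \<delta> inp g k (v @ [i])) Up) else None))"

text \<open>Information travels one edge per round, and \<open>k < length w\<close> keeps it below
  \<open>a\<close> and \<open>a'\<close>.\<close>

lemma interior_state_shift:
  assumes "k < length w" "set w \<subseteq> {..<\<delta>}"
    and "\<And>u. u \<in> words \<delta> (length w + k) \<Longrightarrow> g (a @ u) = g' (a' @ u)"
  shows "interior_state A \<delta> inp g k (a @ w) = interior_state A \<delta> inp g' k (a' @ w)"
  using assms
proof (induction k arbitrary: w)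
  case 0
  then show ?case using 0(3)[of w] by (simp add: words_iff)
next
  case (Suc k)
  have w: "w \<noteq> []" using Suc.prems(1) by auto
  have "interior_state A \<delta> inp g k (a @ w) = interior_state A \<delta> inp g' k (a' @ w)"
    using Suc.prems by (intro Suc.IH) (auto simp: words_iff)
  moreover have "interior_state A \<delta> inp g k (a @ butlast w) = interior_state A \<delta> inp g' k (a' @ butlast w)"
    using Suc.prems by (intro Suc.IH) (auto simp: words_iff dest: in_set_butlastD)
  moreover have "interior_state A \<delta> inp g k (a @ w @ [i]) = interior_state A \<delta> inp g' k (a' @ w @ [i])"
    if "i < \<delta>" for i
    using Suc.prems that by (intro Suc.IH) (auto simp: words_iff)
  moreover have "butlast (b @ w) = b @ butlast w" "last (b @ w) = last w" for b
    using w by (simp_all add: butlast_append)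
  ultimately show ?case
    unfolding interior_state.simps
    by (intro arg_cong2[where f = "receive A"] ext) (simp_all split: port.split)
qed

text \<open>All nodes within distance \<open>k\<close> of \<open>v\<close> lie strictly below the
  root and above depth \<open>D\<close>, so they have a parent and \<delta> children, and their
  inputs differ only in identifiers and random bits.\<close>

lemma state_after_interior:
  assumes t: "\<And>v. v \<in> words \<delta> D \<Longrightarrow> length v < D \<Longrightarrow> arity t v = \<delta>"
    and inp: "\<And>x. inp x = \<lparr>ident = x, deg = \<delta> + 1, has_parent = True,
        num_nodes = card (nodes t), max_deg = max_degree t\<rparr>"
    and "k < length v" "length v + k < D" "set v \<subseteq> {..<\<delta>}"
  shows "state_after A t ids rnd k v = interior_state A \<delta> inp (\<lambda>u. (ids u, rnd u)) k v"
  using assms(3-)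
proof (induction k arbitrary: v)
  case 0
  then have "v \<noteq> []" "arity t v = \<delta>" using t by (auto simp: words_iff)
  then show ?case by (simp add: inp input_of_def degree_def)
next
  case (Suc k)
  then have v: "v \<noteq> []" "arity t v = \<delta>" using t by (auto simp: words_iff)
  let ?f = "interior_state A \<delta> inp (\<lambda>u. (ids u, rnd u)) k"
  have 1: "state_after A t ids rnd k v = ?f v"
    using Suc.prems by (intro Suc.IH) auto
  have 2: "state_after A t ids rnd k (butlast v) = ?f (butlast v)"
    using Suc.prems by (intro Suc.IH) (auto dest: in_set_butlastD)
  have 3: "state_after A t ids rnd k (v @ [i]) = ?f (v @ [i])" if "i < \<delta>" for i
    using Suc.prems that by (intro Suc.IH) auto
  have "map_option (\<lambda>(u, p'). send A (state_after A t ids rnd k u) p') (neighbor t v p) =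
      (case p of Up \<Rightarrow> Some (send A (?f (butlast v)) (Down (last v)))
        | Down i \<Rightarrow> if i < \<delta> then Some (send A (?f (v @ [i])) Up) else None)" for p
    using v 2 3 by (cases p) (auto simp: neighbor_def)
  then show ?case using 1 by simp
qed

text \<open>Forcing a decision in round \<open>T\<close> makes the output local even for assignments of
  identifiers on which the algorithm does not stop.\<close>

definition interior_output ::
    "('r, 's, 'm, 'l) local_alg \<Rightarrow> nat \<Rightarrow> (nat \<Rightarrow> local_input) \<Rightarrow> nat \<Rightarrow> (nat list \<Rightarrow> nat \<times> 'r) \<Rightarrow>
      nat list \<Rightarrow> 'l" where
  "interior_output A \<delta> inp T g v =
     (let D = \<lambda>k. decide A (interior_state A \<delta> inp g k v) in the (D (LEAST k. k = T \<or> D k \<noteq> None)))"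

lemma Least_cong_le:
  fixes T :: nat
  assumes "Q T" "\<And>k. k \<le> T \<Longrightarrow> Q k \<longleftrightarrow> R k"
  shows "(LEAST k. Q k) = (LEAST k. R k)" "(LEAST k. Q k) \<le> T"
proof -
  show le: "(LEAST k. Q k) \<le> T" using assms(1) by (rule Least_le)
  have "R (LEAST k. Q k)" using LeastI[of Q, OF assms(1)] assms(2) le by blast
  moreover have "(LEAST k. Q k) \<le> y" if "R y" for y
    using that assms(2)[of y] le Least_le[of Q y] by (cases "y \<le> T") auto
  ultimately show "(LEAST k. Q k) = (LEAST k. R k)" by (intro Least_equality[symmetric])
qed

lemma interior_output_shift:
  assumes "T < length w" "set w \<subseteq> {..<\<delta>}"
    and "\<And>u. u \<in> words \<delta> (length w + T) \<Longrightarrow> g (a @ u) = g' (a' @ u)"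
  shows "interior_output A \<delta> inp T g (a @ w) = interior_output A \<delta> inp T g' (a' @ w)"
proof -
  let ?D = "\<lambda>k. decide A (interior_state A \<delta> inp g k (a @ w))"
  let ?D' = "\<lambda>k. decide A (interior_state A \<delta> inp g' k (a' @ w))"
  have eq: "?D k = ?D' k" if "k \<le> T" for k
    using assms that
    by (intro arg_cong[where f = "decide A"] interior_state_shift) (auto simp: words_iff)
  have m: "(LEAST k. k = T \<or> ?D k \<noteq> None) = (LEAST k. k = T \<or> ?D' k \<noteq> None)"
    "(LEAST k. k = T \<or> ?D k \<noteq> None) \<le> T"
    by (rule Least_cong_le[where T = T and R = "\<lambda>k. k = T \<or> ?D' k \<noteq> None"]; simp add: eq)+
  then have "?D (LEAST k. k = T \<or> ?D k \<noteq> None) = ?D' (LEAST k. k = T \<or> ?D' k \<noteq> None)"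
    using eq[OF m(2)] by (simp only:)
  then show ?thesis unfolding interior_output_def Let_def by (simp only:)
qed

lemma final_label_interior:
  assumes t: "\<And>v. v \<in> words \<delta> D \<Longrightarrow> length v < D \<Longrightarrow> arity t v = \<delta>"
    and inp: "\<And>x. inp x = \<lparr>ident = x, deg = \<delta> + 1, has_parent = True,
        num_nodes = card (nodes t), max_deg = max_degree t\<rparr>"
    and v: "T < length v" "length v + T < D" "set v \<subseteq> {..<\<delta>}"
    and stop: "j \<le> T" "output_after A t ids rnd j v \<noteq> None"
  shows "final_label A t ids rnd v = interior_output A \<delta> inp T (\<lambda>u. (ids u, rnd u)) v"
proof -
  let ?D = "\<lambda>k. output_after A t ids rnd k v"
  let ?D' = "\<lambda>k. decide A (interior_state A \<delta> inp (\<lambda>u. (ids u, rnd u)) k v)"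
  have eq: "?D k = ?D' k" if "k \<le> T" for k
    unfolding output_after_def using v that
    by (intro arg_cong[where f = "decide A"] state_after_interior[OF t inp]) auto
  let ?m = "LEAST k. ?D k \<noteq> None"
  have m: "?D ?m \<noteq> None" "?m \<le> T"
    using LeastI[of "\<lambda>k. ?D k \<noteq> None", OF stop(2)] Least_le[of "\<lambda>k. ?D k \<noteq> None", OF stop(2)]
      stop(1) by auto
  \<comment> \<open>The node decides by round \<open>T\<close>, so the forced decision does not
    change its first output.\<close>
  have "(LEAST k. k = T \<or> ?D' k \<noteq> None) = ?m"
  proof (rule Least_equality)
    show "?m = T \<or> ?D' ?m \<noteq> None" using m eq by simp
  next
    fix y assume y: "y = T \<or> ?D' y \<noteq> None"
    show "?m \<le> y"
    proof (cases "y < T")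
      case True
      then show ?thesis using y eq[of y] by (intro Least_le) simp
    qed (use m(2) in simp)
  qed
  then show ?thesis unfolding final_label_def interior_output_def Let_def using m(2) eq by simp
qed

lemma running_time_le_iff:
  "running_time A t ids rnd \<le> enat T \<longleftrightarrow>
     (\<forall>v \<in> nodes t. \<exists>k \<le> T. output_after A t ids rnd k v \<noteq> None)"
proof -
  have "(INF k \<in> {k. Q k}. enat k) \<le> enat T \<longleftrightarrow> (\<exists>k \<le> T. Q k)" for Q
  proof
    assume "(INF k \<in> {k. Q k}. enat k) \<le> enat T"
    \<comment> \<open>Only a strict bound on an infimum yields an element below it.\<close>
    then have "(INF k \<in> {k. Q k}. enat k) < enat (Suc T)"
      by (meson enat_ord_simps(2) le_less_trans lessI)
    then show "\<exists>k \<le> T. Q k" unfolding INF_less_iff by (auto simp: less_Suc_eq_le)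
  next
    assume "\<exists>k \<le> T. Q k"
    then show "(INF k \<in> {k. Q k}. enat k) \<le> enat T" by (auto intro: INF_lower2)
  qed
  then show ?thesis unfolding running_time_def by (simp add: SUP_le_iff)
qed

section \<open>Derandomization\<close>

lemma prob_space_random_bits: "prob_space random_bits"
  unfolding random_bits_def by (intro prob_space_PiM prob_space_measure_pmf)

text \<open>Union bound with the random bits attached to identifiers instead of nodes: each placement
  of the identifiers fails with probability at most \<open>1/n\<close>, and there are fewer than \<open>n\<close> placements of
  \<open>K\<close> on \<open>B\<close>.\<close>

lemma derandomize:
  fixes A :: "(nat \<Rightarrow> bool, 's, 'm, 'l) local_alg"
  assumes A: "rand_solves q P A"
    and t: "full_tree (delta P) t" "card (nodes t) = n" "n \<le> q n"
    and B: "B \<subseteq> nodes t" and K: "K \<subseteq> {1..n}" and small: "card K ^ card B < n"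
  shows "\<exists>\<beta>. \<forall>h. inj_on h B \<longrightarrow> h ` B \<subseteq> K \<longrightarrow>
    (\<exists>ids rnd. valid_instance q (delta P) t ids \<and> succeeds P A t ids rnd \<and>
      (\<forall>v \<in> B. ids v = h v \<and> rnd v = \<beta> (h v)))"
proof -
  have finB: "finite B" using B finite_subset finite_nodes by blast
  have finK: "finite K" using K finite_subset by blast
  define F where "F = {h \<in> B \<rightarrow>\<^sub>E K. inj_on h B}"
  have finF: "finite F" unfolding F_def using finB finK by (simp add: finite_PiE)
  have "card F \<le> card (B \<rightarrow>\<^sub>E K)" unfolding F_def using finB finK by (intro card_mono finite_PiE) auto
  then have cardF: "card F < n" using small finB by (simp add: card_PiE)

  have "\<exists>ids. inj_on ids (nodes t) \<and> ids ` nodes t \<subseteq> {1..n} \<and> (\<forall>v \<in> B. ids v = h v)" if "h \<in> F" for h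
    using that B K t(2) unfolding F_def by (intro extend_injection) auto
  then obtain ids where ids: "\<And>h. h \<in> F \<Longrightarrow>
      inj_on (ids h) (nodes t) \<and> ids h ` nodes t \<subseteq> {1..n} \<and> (\<forall>v \<in> B. ids h v = h v)"
    by metis
  have valid: "valid_instance q (delta P) t (ids h)" if "h \<in> F" for h
    unfolding valid_instance_def using t ids[OF that] by (auto intro: order_trans)

  define M where "M = (\<Pi>\<^sub>M i \<in> {1..n}. random_bits)"
  interpret M: prob_space M unfolding M_def by (intro prob_space_PiM prob_space_random_bits)
  define pull where "pull h \<omega> = (\<lambda>v \<in> nodes t. \<omega> (ids h v))" for h and \<omega> :: "nat \<Rightarrow> nat \<Rightarrow> bool"
  define good where "good h = {rnd \<in> space (random_input t). succeeds P A t (ids h) rnd}" for h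
  have pull_measurable: "pull h \<in> M \<rightarrow>\<^sub>M random_input t" if "h \<in> F" for h
    unfolding M_def random_input_def pull_def using ids[OF that]
    by (intro measurable_restrict measurable_component_singleton) auto
  \<comment> \<open>Distinct nodes have distinct identifiers, so pulling independent bits back along
    \<open>ids h\<close> gives independent bits at the nodes.\<close>
  have pull_distr: "distr M (random_input t) (pull h) = random_input t" if "h \<in> F" for h
    unfolding M_def random_input_def pull_def using ids[OF that]
    by (intro distr_PiM_reindex prob_space_random_bits) auto
  have bad: "M.prob (space M - pull h -` good h \<inter> space M) \<le> 1 / n"
    and good_sets: "pull h -` good h \<inter> space M \<in> sets M" if "h \<in> F" for h
  proof -
    have "card F \<noteq> 0" using that finF by auto
    then have "n > 1" using cardF by simp
    have "measure (random_input t) (good h) \<ge> 1 - 1 / card (nodes t)"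
      using A valid[OF that] unfolding rand_solves_def good_def by blast
    then have p: "measure (random_input t) (good h) \<ge> 1 - 1 / n" unfolding t(2) .
    \<comment> \<open>Non-measurable sets have measure 0 by default, so positive measure shows that
      success is measurable.\<close>
    then have "measure (random_input t) (good h) \<noteq> 0" using \<open>n > 1\<close> by (auto simp: field_simps)
    then have sets: "good h \<in> sets (random_input t)" using measure_notin_sets by blast
    then show "pull h -` good h \<inter> space M \<in> sets M"
      using pull_measurable[OF that] by (rule measurable_sets[rotated])
    then show "M.prob (space M - pull h -` good h \<inter> space M) \<le> 1 / n"
      using p measure_distr[OF pull_measurable[OF that] sets] pull_distr[OF that]
      by (simp add: M.prob_compl)
  qed
  have "M.prob (\<Union>h \<in> F. space M - pull h -` good h \<inter> space M)
      \<le> (\<Sum>h \<in> F. M.prob (space M - pull h -` good h \<inter> space M))"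
    using finF good_sets by (intro M.finite_measure_subadditive_finite) auto
  also have "\<dots> \<le> (\<Sum>h \<in> F. 1 / n)" by (rule sum_mono) (rule bad)
  also have "\<dots> < 1" using cardF by simp
  finally have "(\<Union>h \<in> F. space M - pull h -` good h \<inter> space M) \<noteq> space M"
    using M.prob_space by force
  then obtain \<beta> where \<beta>: "\<beta> \<in> space M" "\<And>h. h \<in> F \<Longrightarrow> pull h \<beta> \<in> good h" by blast
  show ?thesis
  proof (intro exI[of _ \<beta>] allI impI)
    fix h assume h: "inj_on h B" "h ` B \<subseteq> K"
    let ?h = "restrict h B"
    have hF: "?h \<in> F" unfolding F_def using h by auto
    have eq: "ids ?h v = h v" if "v \<in> B" for v using ids[OF hF] that by simp
    have "pull ?h \<beta> v = \<beta> (h v)" if "v \<in> B" for v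
      unfolding pull_def using eq[OF that] B that by auto
    then show "\<exists>ids rnd. valid_instance q (delta P) t ids \<and> succeeds P A t ids rnd \<and>
      (\<forall>v \<in> B. ids v = h v \<and> rnd v = \<beta> (h v))"
      using valid[OF hF] \<beta>(2)[OF hF] eq unfolding good_def
      by (intro exI[of _ "ids ?h"] exI[of _ "pull ?h \<beta>"]) simp
  qed
qed

text \<open>The tree is complete to depth \<open>4 * T + 5\<close>, one level beyond the words
  carrying prescribed identifiers, so all those nodes have \<open>delta P\<close> children. With
  random bits given by \<beta>, the forced outputs form a \<open>local_labeling\<close>.\<close>

lemma certificate_if_fast:
  fixes A :: "(nat \<Rightarrow> bool, 's, 'm, 'l) local_alg"
  assumes P: "lcl_problem P" and A: "rand_solves q P A" and q: "n \<le> q n"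
    and n: "n \<in> tree_sizes (delta P)" and time: "worst_case_time q (delta P) A n \<le> enat T"
    and depth: "card (words (delta P) (4 * T + 5)) \<le> n"
    and k: "card (words (delta P) (4 * T + 4)) \<le> k" "m * card (words (delta P) (2 * T + 2)) \<le> k"
    and m: "iter_exp (2 * T + 1) (card (labels P)) < m"
    and small: "((card (labels P) + 1) * k) ^ card (words (delta P) (4 * T + 4)) < n"
  shows "\<exists>S d tr lab a bs. constant_certificate P S d tr lab a bs"
proof -
  let ?\<delta> = "delta P"
  have delta: "?\<delta> \<ge> 1" using P by (simp add: lcl_problem_def)
  obtain t where t: "full_tree ?\<delta> t" "card (nodes t) = n" "words ?\<delta> (4 * T + 5) \<subseteq> nodes t"
    and ar: "\<And>v. v \<in> words ?\<delta> (4 * T + 5) \<Longrightarrow> length v < 4 * T + 5 \<Longrightarrow> arity t v = ?\<delta>"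
    using exists_full_tree_with_complete_top[OF delta n depth] by blast
  let ?B = "words ?\<delta> (4 * T + 4)"
  have BN: "?B \<subseteq> nodes t" using t(3) words_mono[of "4 * T + 4" "4 * T + 5" ?\<delta>] by auto
  let ?N = "(card (labels P) + 1) * k"
  \<comment> \<open>A nonzero exponent gives \<open>?N \<le> ?N ^ card ?B < n\<close>, so the
    identifiers used fit into \<open>{1..n}\<close>.\<close>
  have "[] \<in> ?B" by (simp add: words_iff)
  then have "card ?B \<noteq> 0" using card_0_eq[OF finite_words] by blast
  then have "?N \<le> ?N ^ card ?B"
    using self_le_power[of ?N "card ?B"] by (cases "?N = 0") (simp_all only: One_nat_def Suc_le_eq neq0_conv)
  then have "{1..?N} \<subseteq> {1..n}" using small by simp
  then obtain \<beta> where \<beta>: "\<And>h. inj_on h ?B \<Longrightarrow> h ` ?B \<subseteq> {1..?N} \<Longrightarrow>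
    (\<exists>ids rnd. valid_instance q ?\<delta> t ids \<and> succeeds P A t ids rnd \<and>
      (\<forall>v \<in> ?B. ids v = h v \<and> rnd v = \<beta> (h v)))"
    using derandomize[OF A t(1,2) q BN, of "{1..?N}"] small by auto
  define inp where "inp x = \<lparr>ident = x, deg = ?\<delta> + 1, has_parent = True,
        num_nodes = card (nodes t), max_deg = max_degree t\<rparr>" for x
  define out where "out h v = interior_output A ?\<delta> inp T (\<lambda>u. (h u, \<beta> (h u))) v" for h v
  have "local_labeling P T {1..?N} out"
  proof
    show "lcl_problem P" by fact
  next
    fix a a' w :: "nat list" and h h' :: "nat list \<Rightarrow> nat"
    assume "T < length w" "set w \<subseteq> {..<?\<delta>}"
      "\<And>u. u \<in> words ?\<delta> (length w + T) \<Longrightarrow> h (a @ u) = h' (a' @ u)"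
    then show "out h (a @ w) = out h' (a' @ w)"
      unfolding out_def by (intro interior_output_shift) auto
  next
    fix h :: "nat list \<Rightarrow> nat" and v :: "nat list"
    assume h: "inj_on h ?B" "h ` ?B \<subseteq> {1..?N}"
      and v: "set v \<subseteq> {..<?\<delta>}" "T < length v" "length v + T < 4 * T + 4"
    obtain ids rnd where inst: "valid_instance q ?\<delta> t ids" "succeeds P A t ids rnd"
      and eq: "\<And>v. v \<in> ?B \<Longrightarrow> ids v = h v \<and> rnd v = \<beta> (h v)"
      using \<beta>[OF h] by blast
    have "running_time A t ids rnd \<le> worst_case_time q ?\<delta> A n"
      unfolding worst_case_time_def using inst(1) t(2) by (intro SUP_upper2[of "(t, ids, rnd)"]) auto
    then have stop: "\<exists>k \<le> T. output_after A t ids rnd k u \<noteq> None" if "u \<in> nodes t" for u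
      using time that running_time_le_iff[of A t ids rnd T] by (metis order_trans)
    have final: "final_label A t ids rnd u = out h u"
      if u: "set u \<subseteq> {..<?\<delta>}" "T < length u" "length u + T \<le> 4 * T + 4" for u
    proof -
      have "u \<in> nodes t" using u t(3) by (auto simp: words_iff)
      then obtain j where j: "j \<le> T" "output_after A t ids rnd j u \<noteq> None" using stop by blast
      have "final_label A t ids rnd u = interior_output A ?\<delta> inp T (\<lambda>u. (ids u, rnd u)) ([] @ u)"
        using final_label_interior[OF ar inp_def u(2) _ u(1) j] u(3) by simp
      also have "\<dots> = interior_output A ?\<delta> inp T (\<lambda>u. (h u, \<beta> (h u))) ([] @ u)"
        using u eq by (intro interior_output_shift) (auto simp: words_iff)
      finally show ?thesis by (simp add: out_def)
    qed
    have vt: "v \<in> nodes t" "arity t v = ?\<delta>" using v t(3) ar[of v] by (auto simp: words_iff)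
    have "solution P t (final_label A t ids rnd)" using inst(2) unfolding succeeds_def by blast
    then obtain \<rho> where \<rho>: "final_label A t ids rnd v \<in> labels P" "\<rho> permutes {..<?\<delta>}"
      "(final_label A t ids rnd v, map (\<lambda>i. final_label A t ids rnd (v @ [\<rho> i])) [0..<?\<delta>]) \<in> configs P"
      using vt unfolding solution_def by blast
    have "final_label A t ids rnd (v @ [\<rho> i]) = out h (v @ [\<rho> i])" if "i < ?\<delta>" for i
      using permutes_in_image[OF \<rho>(2), of i] that v by (intro final) auto
    then have map_eq: "map (\<lambda>i. final_label A t ids rnd (v @ [\<rho> i])) [0..<?\<delta>] =
        map (\<lambda>i. out h (v @ [\<rho> i])) [0..<?\<delta>]" by simp
    moreover have "final_label A t ids rnd v = out h v" using v by (intro final) auto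
    ultimately show "out h v \<in> labels P \<and> (\<exists>\<rho>. \<rho> permutes {..<?\<delta>} \<and>
        (out h v, map (\<lambda>i. out h (v @ [\<rho> i])) [0..<?\<delta>]) \<in> configs P)"
      using \<rho> by metis
  qed
  then show ?thesis
    using local_labeling.exists_constant_certificate k m by blast
qed


section \<open>The lower bound\<close>

lemma enat_less_SucD: "x < enat (Suc k) \<Longrightarrow> x \<le> enat k"
  by (cases x) auto

text \<open>Take \<open>m = M\<close> and \<open>k = M * M\<close> for a tower \<open>M\<close> of
  height \<open>2 * T + 2\<close>. It bounds all word counts, and the number of placements is at
  most \<open>2 ^ (3 * M * M)\<close>, which four more exponentials absorb.\<close>

lemma tower_dominates_placements:
  fixes \<delta> s :: nat
  shows "\<exists>L. \<forall>T n. iter_exp (2 * T + L) 1 < n \<longrightarrow>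
    (\<exists>k m. card (words \<delta> (4 * T + 5)) \<le> n \<and> card (words \<delta> (4 * T + 4)) \<le> k \<and>
      m * card (words \<delta> (2 * T + 2)) \<le> k \<and> iter_exp (2 * T + 1) s < m \<and>
      ((s + 1) * k) ^ card (words \<delta> (4 * T + 4)) < n)"
proof (rule exI[of _ "6 + (s + 1 + 3 * \<delta>)"], intro allI impI)
  fix T n :: nat
  assume n: "iter_exp (2 * T + (6 + (s + 1 + 3 * \<delta>))) 1 < n"
  \<comment> \<open>The summand \<open>3 * \<delta>\<close> ensures
    \<open>\<delta> * (4 * T + 5) \<le> b * (2 * T + 2)\<close>. In \<open>L\<close>, the 6 counts
    two levels of \<open>M\<close> and four above it, and \<open>b\<close> further levels allow the
    top to be 1 instead of \<open>b\<close>.\<close>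
  define b where "b = s + 1 + 3 * \<delta>"
  define M where "M = iter_exp (2 * T + 2) b"
  have M_eq: "M = 2 ^ iter_exp (2 * T + 1) b" unfolding M_def by simp
  have "b \<le> iter_exp b 1" using iter_exp_ge[of 1 b] by simp
  then have "iter_exp (2 * T + 6) b \<le> iter_exp (2 * T + 6) (iter_exp b 1)" by (rule iter_exp_mono)
  also have "\<dots> = iter_exp (2 * T + (6 + b)) 1" by (simp only: iter_exp_add[symmetric] add.assoc)
  also have "\<dots> < n" using n unfolding b_def .
  finally have "iter_exp (4 + (2 * T + 2)) b < n" by (simp add: add.commute)
  then have n': "iter_exp 4 M < n" unfolding iter_exp_add M_def by simp
  have sM: "s + 1 \<le> M" using iter_exp_ge[of b "2 * T + 2"] unfolding M_def b_def by linarith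
  have cM: "card (words \<delta> l) \<le> M" if "l \<le> 4 * T + 5" for l
  proof -
    have "card (words \<delta> l) \<le> (\<delta> + 1) ^ l" by (rule card_words_le)
    also have "\<dots> \<le> (2 ^ \<delta>) ^ l"
      using Suc_leI[OF less_exp[of \<delta>]] by (intro power_mono) auto
    also have "\<dots> = 2 ^ (\<delta> * l)" by (simp add: power_mult)
    also have "\<dots> \<le> M"
    proof -
      have "\<delta> * l \<le> \<delta> * (4 * T + 5)" using that by simp
      also have "\<dots> \<le> b * (2 * T + 1 + 1)" by (simp add: b_def algebra_simps)
      also have "\<dots> \<le> iter_exp (2 * T + 1) b" by (rule iter_exp_ge_mult)
      finally show ?thesis unfolding M_eq by (rule power_increasing) simp
    qed
    finally show ?thesis .
  qed
  have "iter_exp (2 * T + 1) s \<le> iter_exp (2 * T + 1) b" unfolding b_def by (rule iter_exp_mono) simp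
  also have "\<dots> < M" unfolding M_eq by (rule less_exp)
  finally have m: "iter_exp (2 * T + 1) s < M" .
  have "((s + 1) * (M * M)) ^ card (words \<delta> (4 * T + 4)) \<le> (M ^ 3) ^ card (words \<delta> (4 * T + 4))"
    using mult_le_mono1[OF sM, of "M * M"]
    by (intro power_mono) (simp_all only: power3_eq_cube mult.assoc le0)
  also have "\<dots> \<le> (M ^ 3) ^ M"
    using sM cM[of "4 * T + 4"] by (intro power_increasing) auto
  also have "\<dots> \<le> ((2 ^ M) ^ 3) ^ M"
    using less_exp[of M] by (intro power_mono) auto
  also have "\<dots> = 2 ^ (3 * M * M)" by (simp add: power_mult[symmetric] mult.commute mult.left_commute)
  also have "\<dots> \<le> 2 ^ (2 ^ (2 ^ (2 ^ M)))"
  proof (rule power_increasing)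
    have "3 * M * M \<le> 4 * 2 ^ M * 2 ^ M"
      using less_exp[of M] by (intro mult_mono) auto
    also have "\<dots> = 2 ^ (2 * (M + 1))" by (simp add: power_add mult_2)
    also have "\<dots> \<le> 2 ^ (2 ^ (2 ^ M))"
    proof (rule power_increasing)
      have "M + 1 \<le> 2 ^ M" using Suc_leI[OF less_exp[of M]] by (simp only: Suc_eq_plus1)
      then have "2 * (M + 1) \<le> 2 * 2 ^ M" by (rule mult_le_mono2)
      also have "\<dots> = 2 ^ (M + 1)" by simp
      also have "\<dots> \<le> 2 ^ (2 ^ M)" using \<open>M + 1 \<le> 2 ^ M\<close> by (rule power_increasing) simp
      finally show "2 * (M + 1) \<le> 2 ^ (2 ^ M)" .
    qed simp
    finally show "3 * M * M \<le> 2 ^ (2 ^ (2 ^ M))" .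
  qed simp
  also have "\<dots> = iter_exp 4 M" by (simp add: numeral_eq_Suc)
  finally have small: "((s + 1) * (M * M)) ^ card (words \<delta> (4 * T + 4)) < n" using n' by simp
  have "M \<le> n" using iter_exp_ge[of M 4] n' by simp
  have "M \<le> M * M" using sM by simp
  show "\<exists>k m. card (words \<delta> (4 * T + 5)) \<le> n \<and> card (words \<delta> (4 * T + 4)) \<le> k \<and>
      m * card (words \<delta> (2 * T + 2)) \<le> k \<and> iter_exp (2 * T + 1) s < m \<and>
      ((s + 1) * k) ^ card (words \<delta> (4 * T + 4)) < n"
  proof (rule exI[of _ "M * M"], rule exI[of _ M], intro conjI)
    show "card (words \<delta> (4 * T + 5)) \<le> n"
      using cM[of "4 * T + 5"] \<open>M \<le> n\<close> by simp
    show "card (words \<delta> (4 * T + 4)) \<le> M * M"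
      using cM[of "4 * T + 4"] \<open>M \<le> M * M\<close> by linarith
    show "M * card (words \<delta> (2 * T + 2)) \<le> M * M"
      using cM[of "2 * T + 2"] by (intro mult_le_mono2) simp
    show "iter_exp (2 * T + 1) s < M" by (rule m)
    show "((s + 1) * (M * M)) ^ card (words \<delta> (4 * T + 4)) < n" by (rule small)
  qed
qed

section \<open>Deterministic algorithms as randomized ones\<close>

definition as_randomized :: "(unit, 's, 'm, 'l) local_alg \<Rightarrow> ('r, 's, 'm, 'l) local_alg" where
  "as_randomized A = \<lparr>start = \<lambda>i _. start A i (), send = send A, receive = receive A, decide = decide A\<rparr>"

lemma state_after_as_randomized:
  "state_after (as_randomized A) t ids rnd k = state_after A t ids rnd' k"
  by (induction k) (simp_all add: as_randomized_def)

lemma output_after_as_randomized: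
  "output_after (as_randomized A) t ids rnd k v = output_after A t ids rnd' k v"
  using state_after_as_randomized[of A t ids rnd k rnd']
  by (simp add: output_after_def as_randomized_def)

lemma rand_complexity_le_det_complexity:
  fixes P :: "'l lcl"
  shows "rand_complexity TYPE('s) TYPE('m) q P n \<le> det_complexity TYPE('s) TYPE('m) q P n"
  unfolding det_complexity_def
proof (rule INF_greatest)
  fix A :: "(unit, 's, 'm, 'l) local_alg" assume A: "A \<in> {A. det_solves q P A}"
  let ?A = "as_randomized A :: (nat \<Rightarrow> bool, 's, 'm, 'l) local_alg"
  have out: "output_after ?A t ids rnd = output_after A t ids (\<lambda>_. ())" for t ids rnd
    by (intro ext) (rule output_after_as_randomized)
  have "succeeds P ?A t ids rnd" if "valid_instance q (delta P) t ids" for t ids rnd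
    using that A unfolding det_solves_def succeeds_def final_label_def out by blast
  moreover have "prob_space (random_input t)" for t
    unfolding random_input_def by (intro prob_space_PiM prob_space_random_bits)
  ultimately have "rand_solves q P ?A"
    unfolding rand_solves_def out by (auto simp: prob_space.prob_space)
  then have "rand_complexity TYPE('s) TYPE('m) q P n \<le> worst_case_time q (delta P) ?A n"
    unfolding rand_complexity_def by (intro INF_lower) simp
  also have "\<dots> \<le> worst_case_time q (delta P) A n"
  proof -
    have "running_time ?A t ids rnd \<le> worst_case_time q (delta P) A n"
      if "valid_instance q (delta P) t ids" "card (nodes t) = n" for t ids rnd
      unfolding worst_case_time_def running_time_def out
      using that by (intro SUP_upper2[of "(t, ids, \<lambda>_. ())"]) auto
    then show ?thesis unfolding worst_case_time_def[of q "delta P" ?A] by (intro SUP_least) auto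
  qed
  finally show "rand_complexity TYPE('s) TYPE('m) q P n \<le> worst_case_time q (delta P) A n" .
qed

theorem theorem7p7:
  fixes P :: "'l lcl" and q :: "nat \<Rightarrow> nat"
  assumes "lcl_problem P"
    and "\<not> (\<exists>S d tr lab a bs. constant_certificate P S d tr lab a bs)"
    and "\<And>n. n \<le> q n"
    and "\<exists>k. (\<lambda>n. real (q n)) \<in> O(\<lambda>n. real n ^ k)"
  shows "rand_complexity TYPE('s) TYPE('m) q P \<in> Omega_on_trees (delta P) log_star \<and>
         det_complexity TYPE('s) TYPE('m) q P \<in> Omega_on_trees (delta P) log_star"
proof -
  obtain L where L: "\<And>T n. iter_exp (2 * T + L) 1 < n \<Longrightarrow>
    (\<exists>k m. card (words (delta P) (4 * T + 5)) \<le> n \<and> card (words (delta P) (4 * T + 4)) \<le> k \<and>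
      m * card (words (delta P) (2 * T + 2)) \<le> k \<and> iter_exp (2 * T + 1) (card (labels P)) < m \<and>
      ((card (labels P) + 1) * k) ^ card (words (delta P) (4 * T + 4)) < n)"
    using tower_dominates_placements by metis
  have bound: "ereal (1 / 4 * real (log_star n)) \<le>
      ereal_of_enat (rand_complexity TYPE('s) TYPE('m) q P n)"
    if n: "n > iter_exp (2 * L) 1" "n \<in> tree_sizes (delta P)" for n
  proof (rule ccontr)
    assume "\<not> ?thesis"
    then obtain T where T: "rand_complexity TYPE('s) TYPE('m) q P n = enat T" "4 * T < log_star n"
      by (cases "rand_complexity TYPE('s) TYPE('m) q P n") auto
    \<comment> \<open>Averaging \<open>4 * T < log_star n\<close> and
      \<open>2 * L < log_star n\<close> gives \<open>2 * T + L < log_star n\<close>; this is the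
      origin of the factor 1/4 and of the threshold for \<open>n\<close>.\<close>
    have "2 * L < log_star n" using n(1) log_star_le_iff[of n "2 * L"] by simp
    then have "iter_exp (2 * T + L) 1 < n"
      using T(2) log_star_le_iff[of n "2 * T + L"] by (simp add: not_le)
    \<comment> \<open>The infimum is below \<open>Suc T\<close>, so some algorithm needs at most
      \<open>T\<close> rounds for this \<open>n\<close>; it may depend on \<open>n\<close>.\<close>
    have "\<exists>A :: (nat \<Rightarrow> bool, 's, 'm, 'l) local_alg.
        rand_solves q P A \<and> worst_case_time q (delta P) A n < enat (Suc T)"
      using T(1) Inf_less_iff[of _ "enat (Suc T)"] unfolding rand_complexity_def
      by (metis (mono_tags, lifting) INF_less_iff enat_ord_simps(2) lessI mem_Collect_eq)
    then obtain A :: "(nat \<Rightarrow> bool, 's, 'm, 'l) local_alg"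
      where "rand_solves q P A" "worst_case_time q (delta P) A n \<le> enat T"
      using enat_less_SucD by blast
    moreover obtain k m where "card (words (delta P) (4 * T + 5)) \<le> n"
      "card (words (delta P) (4 * T + 4)) \<le> k" "m * card (words (delta P) (2 * T + 2)) \<le> k"
      "iter_exp (2 * T + 1) (card (labels P)) < m"
      "((card (labels P) + 1) * k) ^ card (words (delta P) (4 * T + 4)) < n"
      using L[OF \<open>iter_exp (2 * T + L) 1 < n\<close>] by blast
    ultimately show False
      using certificate_if_fast[OF assms(1) \<open>rand_solves q P A\<close> assms(3) n(2)] assms(2) by blast
  qed
  have rand: "\<forall>\<^sub>F n in sequentially. n \<in> tree_sizes (delta P) \<longrightarrow>
      ereal (1 / 4 * real (log_star n)) \<le> ereal_of_enat (rand_complexity TYPE('s) TYPE('m) q P n)"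
    using eventually_gt_at_top[of "iter_exp (2 * L) 1"] by eventually_elim (use bound in blast)
  then have "\<forall>\<^sub>F n in sequentially. n \<in> tree_sizes (delta P) \<longrightarrow>
      ereal (1 / 4 * real (log_star n)) \<le> ereal_of_enat (det_complexity TYPE('s) TYPE('m) q P n)"
    by eventually_elim
      (metis ereal_of_enat_le_iff order_trans rand_complexity_le_det_complexity)
  with rand show ?thesis
    unfolding Omega_on_trees_def by (auto intro!: exI[of _ "1 / 4"])
qed

end
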